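(* For all integers $0\le r\le n$, the polytopes $\Omega_{r,n}$ and $\overline{\Omega}_{r,n}$ have codimension $1$ in their ambient spaces; that is, $\dim\Omega_{r,n}=|\mathcal{S}_{r,n}|-1$ and $\dim\overline{\Omega}_{r,n}=|\overline{\mathcal{S}}_{r,n}|-1$.
   Context: For integers $0\le r\le n$, $\overline{\mathcal{M}}_{r,n}$ is the set of matroids with ground set $[n]=\{1,\dots,n\}$ and rank $r$, and $\mathcal{M}_{r,n}$ the set of isomorphism classes of such matroids; $[\mathsf{M}]$ denotes the class of $\mathsf{M}$. The base polytope $\mathscr{P}(\mathsf{M})\subseteq\mathbb{R}^n$ is the convex hull of the $0/1$ indicator vectors of the bases of $\mathsf{M}$; $\mathbf{1}_X$ is the indicator function of $X\subseteq\mathbb{R}^n$. A Schubert matroid is a matroid whose lattice of cyclic flats is a chain; $\overline{\mathcal{S}}_{r,n}\subseteq\overline{\mathcal{M}}_{r,n}$ is the set of Schubert matroids and $\mathcal{S}_{r,n}$ the set of their isomorphism classes. For each $\mathsf{M}\in\overline{\mathcal{M}}_{r,n}$ there are unique integers $a_{\mathsf{S}}(\mathsf{M})$ ($\mathsf{S}\in\overline{\mathcal{S}}_{r,n}$) with $\mathbf{1}_{\mathscr{P}(\mathsf{M})}=\sum_{\mathsf{S}}a_{\mathsf{S}}(\mathsf{M})\mathbf{1}_{\mathscr{P}(\mathsf{S})}$. Let $\overline{p}_{\mathsf{M}}=(a_{\mathsf{S}}(\mathsf{M}))_{\mathsf{S}\in\overline{\mathcal{S}}_{r,n}}\in\mathbb{Z}^{\overline{\mathcal{S}}_{r,n}}$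 and let $p_{[\mathsf{M}]}\in\mathbb{Z}^{\mathcal{S}_{r,n}}$ be the vector whose coordinate at a class $c\in\mathcal{S}_{r,n}$ is $\sum_{\mathsf{S}\in c}a_{\mathsf{S}}(\mathsf{M})$ (it depends only on $[\mathsf{M}]$). Then $\overline{\Omega}_{r,n}=\operatorname{conv}\{\overline{p}_{\mathsf{M}}:\mathsf{M}\in\overline{\mathcal{M}}_{r,n}\}\subseteq\mathbb{R}^{\overline{\mathcal{S}}_{r,n}}$ and $\Omega_{r,n}=\operatorname{conv}\{p_{[\mathsf{M}]}:[\mathsf{M}]\in\mathcal{M}_{r,n}\}\subseteq\mathbb{R}^{\mathcal{S}_{r,n}}$. *)

theory Defs
  imports "HOL-Analysis.Analysis" "HOL-Analysis.Finite_Function_Topology"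
begin

text \<open>
  A matroid on the ground set \<open>{1..n}\<close> is represented by its set of bases, so that equality of
  matroids (for fixed \<open>n\<close>) is equality of sets of bases.
\<close>

type_synonym matroid = "nat set set"

definition matroids :: "nat \<Rightarrow> nat \<Rightarrow> matroid set" where
  "matroids r n = {M. M \<noteq> {} \<and> (\<forall>A\<in>M. A \<subseteq> {1..n} \<and> card A = r) \<and>
     (\<forall>A\<in>M. \<forall>B\<in>M. \<forall>x\<in>A - B. \<exists>y\<in>B - A. insert y (A - {x}) \<in> M)}"

definition indep :: "matroid \<Rightarrow> nat set \<Rightarrow> bool" where
  "indep M X \<longleftrightarrow> (\<exists>B\<in>M. X \<subseteq> B)"

definition rank_of :: "matroid \<Rightarrow> nat set \<Rightarrow> nat" where
  "rank_of M X = Max ((\<lambda>B. card (B \<inter> X)) ` M)"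

definition circuits :: "nat \<Rightarrow> matroid \<Rightarrow> nat set set" where
  "circuits n M = {C. C \<subseteq> {1..n} \<and> \<not> indep M C \<and> (\<forall>D. D \<subset> C \<longrightarrow> indep M D)}"

definition flats :: "nat \<Rightarrow> matroid \<Rightarrow> nat set set" where
  "flats n M = {F. F \<subseteq> {1..n} \<and> (\<forall>e\<in>{1..n} - F. rank_of M F < rank_of M (insert e F))}"

definition cyclic_flats :: "nat \<Rightarrow> matroid \<Rightarrow> nat set set" where
  "cyclic_flats n M = {F \<in> flats n M. \<exists>\<C>. \<C> \<subseteq> circuits n M \<and> F = \<Union>\<C>}"

definition schubert_matroids :: "nat \<Rightarrow> nat \<Rightarrow> matroid set" where
  "schubert_matroids r n = {M \<in> matroids r n. chain\<^sub>\<subseteq> (cyclic_flats n M)}"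

definition matroid_iso :: "nat \<Rightarrow> nat \<Rightarrow> (matroid \<times> matroid) set" where
  "matroid_iso r n = {(M, N). M \<in> matroids r n \<and> N \<in> matroids r n \<and>
     (\<exists>\<sigma>. bij_betw \<sigma> {1..n} {1..n} \<and> N = (\<lambda>B. \<sigma> ` B) ` M)}"

definition schubert_classes :: "nat \<Rightarrow> nat \<Rightarrow> matroid set set" where
  "schubert_classes r n = schubert_matroids r n // matroid_iso r n"

text \<open>
  For a finite index set \<open>I\<close>, the space of real vectors indexed by \<open>I\<close> is rendered as the subspace
  of those \<open>x :: 'i \<Rightarrow>\<^sub>0 real\<close> with \<open>Poly_Mapping.keys x \<subseteq> I\<close>. This lets \<open>I\<close> depend on \<open>r\<close>
  and \<open>n\<close>, and it allows \<open>I = {}\<close>.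
\<close>

definition indicator_vec :: "nat set \<Rightarrow> nat \<Rightarrow>\<^sub>0 real" where
  "indicator_vec B = (\<Sum>i\<in>B. Poly_Mapping.single i 1)"

definition base_polytope :: "matroid \<Rightarrow> (nat \<Rightarrow>\<^sub>0 real) set" where
  "base_polytope M = convex hull (indicator_vec ` M)"

text \<open>
  The coefficient family is extended by \<open>0\<close> outside the Schubert matroids, so that \<open>THE\<close> describes
  a unique function.
\<close>

definition schubert_coeff :: "nat \<Rightarrow> nat \<Rightarrow> matroid \<Rightarrow> matroid \<Rightarrow> int" where
  "schubert_coeff r n M = (THE a. (\<forall>S. S \<notin> schubert_matroids r n \<longrightarrow> a S = 0) \<and>
     (\<forall>x. Poly_Mapping.keys x \<subseteq> {1..n} \<longrightarrow>
        indicator (base_polytope M) x =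
          (\<Sum>S\<in>schubert_matroids r n. a S * indicator (base_polytope S) x)))"

definition matroid_vec :: "nat \<Rightarrow> nat \<Rightarrow> matroid \<Rightarrow> matroid \<Rightarrow>\<^sub>0 real" where
  "matroid_vec r n M =
     (\<Sum>S\<in>schubert_matroids r n. Poly_Mapping.single S (of_int (schubert_coeff r n M S)))"

definition class_vec :: "nat \<Rightarrow> nat \<Rightarrow> matroid \<Rightarrow> matroid set \<Rightarrow>\<^sub>0 real" where
  "class_vec r n M =
     (\<Sum>c\<in>schubert_classes r n. Poly_Mapping.single c (of_int (\<Sum>S\<in>c. schubert_coeff r n M S)))"

definition Omega_bar :: "nat \<Rightarrow> nat \<Rightarrow> (matroid \<Rightarrow>\<^sub>0 real) set" where
  "Omega_bar r n = convex hull (matroid_vec r n ` matroids r n)"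

text \<open>
  \<open>class_vec r n M\<close> depends only on the isomorphism class of \<open>M\<close>, so letting \<open>M\<close> range over all
  matroids yields one point for each isomorphism class.
\<close>

definition Omega :: "nat \<Rightarrow> nat \<Rightarrow> (matroid set \<Rightarrow>\<^sub>0 real) set" where
  "Omega r n = convex hull (class_vec r n ` matroids r n)"

text \<open>
  The library's \<open>aff_dim\<close> is restricted to the class \<open>euclidean_space\<close>, which excludes
  \<open>'i \<Rightarrow>\<^sub>0 real\<close>. Here the affine dimension is the linear dimension of the direction space of
  the affine hull, with the same convention \<open>-1\<close> for the empty set. As for \<open>dim\<close>, the value is
  meaningful only when that space is finite-dimensional.
\<close>

definition affine_dim :: "'a::real_vector set \<Rightarrow> int" where
  "affine_dim P = (if P = {} then -1
     else int (dim {x - y | x y. x \<in> affine hull P \<and> y \<in> affine hull P}))"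

end

theory Submission
  imports Defs
begin

text \<open>
  Write \<open>x(F)\<close> for the sum of the coordinates of \<open>x\<close> in \<open>F\<close>. The base polytope of a matroid \<open>M\<close> is cut
  out of the hypersimplex by the inequalities \<open>x(F) \<le> rk(F)\<close>. For a chain \<open>C\<close> of subsets of the
  ground set, the inequalities with \<open>F \<in> C\<close> alone cut out the base polytope of a Schubert matroid
  \<open>N(C)\<close>. For a point \<open>x\<close> of the hypersimplex the function \<open>x(F) - rk(F)\<close> is supermodular, so the family of
  violated sets is empty or closed under joining with a member where this function is maximal; in the latter
  case the alternating sum over its chains vanishes. Moebius inversion over chains then gives integers
  \<open>l(C)\<close> with total sum 1 such that the indicator function of the polytope of \<open>M\<close> is
  the sum of \<open>l(C)\<close> times that of the polytope of \<open>N(C)\<close>.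

  The indicator functions of Schubert matroid polytopes are linearly independent: by the Euler
  characteristic, \<open>[rk(F) = \<rho>(F) for all F in a chain]\<close> is a linear function of the indicator
  function. Taking the cyclic flats of a Schubert matroid \<open>S\<close> with their ranks, it is nonzero only on
  matroids contained in \<open>S\<close>, so it is triangular with respect to inclusion.

  Hence all vectors lie in the hyperplane where the coordinates sum to 1, and Schubert matroids give the
  unit vectors.
\<close>

subsection \<open>Rank and independence\<close>

lemma chain_subset_mono: "chain\<^sub>\<subseteq> C \<Longrightarrow> D \<subseteq> C \<Longrightarrow> chain\<^sub>\<subseteq> D"
  unfolding chain_subset_def by blast

lemma chain_subset_insert:
  "chain\<^sub>\<subseteq> C \<Longrightarrow> (\<And>F. F \<in> C \<Longrightarrow> F \<subseteq> G \<or> G \<subseteq> F) \<Longrightarrow> chain\<^sub>\<subseteq> (insert G C)"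
  unfolding chain_subset_def by blast

lemma matroidsD:
  assumes "M \<in> matroids r n"
  shows "M \<noteq> {}" "\<And>A. A \<in> M \<Longrightarrow> A \<subseteq> {1..n}" "\<And>A. A \<in> M \<Longrightarrow> card A = r"
    "\<And>A. A \<in> M \<Longrightarrow> finite A" "finite M"
    "\<And>A B x. A \<in> M \<Longrightarrow> B \<in> M \<Longrightarrow> x \<in> A \<Longrightarrow> x \<notin> B \<Longrightarrow> \<exists>y\<in>B - A. insert y (A - {x}) \<in> M"
proof -
  show sub: "A \<subseteq> {1..n}" if "A \<in> M" for A
    using assms that by (auto simp: matroids_def)
  show "finite A" if "A \<in> M" for A
    using sub[OF that] finite_subset by blast
  have "M \<subseteq> Pow {1..n}"
    using sub by blast
  then show "finite M"
    using finite_subset by blast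
qed (use assms in \<open>auto simp: matroids_def\<close>)

lemma chain_Union_mem:
  assumes "finite C" "C \<noteq> {}" "chain\<^sub>\<subseteq> C"
  shows "\<Union>C \<in> C"
proof -
  obtain G where G: "G \<in> C" "\<forall>F\<in>C. G \<subseteq> F \<longrightarrow> G = F"
    using finite_has_maximal[OF assms(1,2)] by blast
  then have "F \<subseteq> G" if "F \<in> C" for F
    using assms(3) that unfolding chain_subset_def by blast
  then have "\<Union>C = G"
    using G by blast
  then show ?thesis
    using G by simp
qed

lemma finite_matroids: "finite (matroids r n)"
  by (rule finite_subset[of _ "Pow (Pow {1..n})"]) (auto simp: matroids_def)

lemma schubert_subset_matroids: "schubert_matroids r n \<subseteq> matroids r n"
  unfolding schubert_matroids_def by blast

lemma finite_schubert_matroids: "finite (schubert_matroids r n)"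
  using schubert_subset_matroids finite_matroids by (rule finite_subset)

lemma indep_subset: "indep M X \<Longrightarrow> Y \<subseteq> X \<Longrightarrow> indep M Y"
  unfolding indep_def by blast

context
  fixes r n :: nat and M :: matroid
  assumes M: "M \<in> matroids r n"
begin

lemma card_inter_le_rank_of: "B \<in> M \<Longrightarrow> card (B \<inter> X) \<le> rank_of M X"
  unfolding rank_of_def using matroidsD(5)[OF M] by (intro Max_ge) auto

lemma rank_of_attained: "\<exists>B\<in>M. card (B \<inter> X) = rank_of M X"
proof -
  have "rank_of M X \<in> (\<lambda>B. card (B \<inter> X)) ` M"
    unfolding rank_of_def using matroidsD(1,5)[OF M] by (intro Max_in) auto
  then show ?thesis
    by auto
qed

lemma rank_of_le:
  assumes "\<And>B. B \<in> M \<Longrightarrow> card (B \<inter> X) \<le> k"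
  shows "rank_of M X \<le> k"
proof -
  obtain B where "B \<in> M" "card (B \<inter> X) = rank_of M X"
    using rank_of_attained by blast
  then show ?thesis
    using assms[of B] by simp
qed

lemma rank_of_mono: "X \<subseteq> Y \<Longrightarrow> rank_of M X \<le> rank_of M Y"
proof (rule rank_of_le)
  fix B assume "X \<subseteq> Y" "B \<in> M"
  then have "card (B \<inter> X) \<le> card (B \<inter> Y)"
    using matroidsD(4)[OF M] by (intro card_mono) auto
  then show "card (B \<inter> X) \<le> rank_of M Y"
    using card_inter_le_rank_of[OF \<open>B \<in> M\<close>, of Y] by linarith
qed

lemma rank_of_ground: "rank_of M {1..n} = r"
proof -
  obtain B where B: "B \<in> M" "card (B \<inter> {1..n}) = rank_of M {1..n}"
    using rank_of_attained by blast
  then have "B \<inter> {1..n} = B"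
    using matroidsD(2)[OF M] by blast
  then show ?thesis
    using B matroidsD(3)[OF M] by simp
qed

lemma basis_iff_rank_of:
  assumes "card B = r" "B \<subseteq> {1..n}"
  shows "B \<in> M \<longleftrightarrow> r \<le> rank_of M B"
proof
  assume "B \<in> M"
  then show "r \<le> rank_of M B"
    using card_inter_le_rank_of[of B B] assms by simp
next
  assume *: "r \<le> rank_of M B"
  obtain A where A: "A \<in> M" "card (A \<inter> B) = rank_of M B"
    using rank_of_attained by blast
  have finB: "finite B"
    using assms finite_subset by blast
  have "A \<inter> B = B"
    using * A assms finB by (intro card_seteq) auto
  moreover have "A \<inter> B = A"
    using * A matroidsD(3,4)[OF M A(1)] by (intro card_seteq) auto
  ultimately show "B \<in> M"
    using A by simp
qed

section \<open>Augmentation, ranks along chains and submodularity\<close>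

lemma indep_finite: "indep M X \<Longrightarrow> finite X"
  unfolding indep_def using matroidsD(4)[OF M] finite_subset by blast

lemma indep_card_le_rank_of:
  assumes "indep M X" "X \<subseteq> Y"
  shows "card X \<le> rank_of M Y"
proof -
  obtain B where B: "B \<in> M" "X \<subseteq> B"
    using assms unfolding indep_def by blast
  have "card X \<le> card (B \<inter> Y)"
    using B assms matroidsD(4)[OF M] by (intro card_mono) auto
  then show ?thesis
    using card_inter_le_rank_of[OF B(1), of Y] by linarith
qed

text \<open>Take a basis \<open>A\<close> above \<open>Y\<close> and a basis \<open>B\<close> above
  \<open>X\<close> meeting \<open>A\<close> in as many elements as possible. Basis exchange then
  forces \<open>B - X\<close> into \<open>A\<close>. If \<open>B\<close> missed
  \<open>Y - X\<close>, then \<open>B - X\<close> would lie in \<open>A - Y\<close>, which is too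
  small because both bases have \<open>r\<close> elements.\<close>

lemma indep_augment:
  assumes "indep M X" "indep M Y" "card X < card Y"
  shows "\<exists>y\<in>Y - X. indep M (insert y X)"
proof -
  obtain A where A: "A \<in> M" "Y \<subseteq> A"
    using assms unfolding indep_def by blast
  obtain B0 where "B0 \<in> M \<and> X \<subseteq> B0"
    using assms unfolding indep_def by blast
  moreover have "\<forall>B. B \<in> M \<and> X \<subseteq> B \<longrightarrow> card (A \<inter> B) < Suc (card A)"
    using matroidsD(4)[OF M A(1)] by (auto simp: less_Suc_eq_le intro: card_mono)
  ultimately obtain B where B: "B \<in> M" "X \<subseteq> B"
    and best: "\<And>B'. B' \<in> M \<Longrightarrow> X \<subseteq> B' \<Longrightarrow> card (A \<inter> B') \<le> card (A \<inter> B)"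
    using ex_has_greatest_nat[of "\<lambda>B. B \<in> M \<and> X \<subseteq> B" B0 "\<lambda>B. card (A \<inter> B)" "Suc (card A)"] by blast
  note fin = matroidsD(4)[OF M A(1)] matroidsD(4)[OF M B(1)]
  have BX: "B - X \<subseteq> A"
  proof
    fix b assume b: "b \<in> B - X"
    show "b \<in> A"
    proof (rule ccontr)
      assume "b \<notin> A"
      then obtain a where a: "a \<in> A - B" "insert a (B - {b}) \<in> M"
        using matroidsD(6)[OF M B(1) A(1)] b by blast
      have "A \<inter> insert a (B - {b}) = insert a (A \<inter> B)"
        using a \<open>b \<notin> A\<close> by blast
      then have "card (A \<inter> insert a (B - {b})) = Suc (card (A \<inter> B))"
        using a fin by simp
      moreover have "X \<subseteq> insert a (B - {b})"
        using b B by blast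
      ultimately show False
        using best[OF a(2)] by simp
    qed
  qed
  show ?thesis
  proof (cases "(Y - X) \<inter> B = {}")
    case True
    have "card (B - X) \<le> card (A - Y)"
      using True BX fin by (intro card_mono) auto
    moreover have "card (B - X) = r - card X" "card X \<le> r"
      using B fin matroidsD(3)[OF M B(1)] card_mono[OF fin(2) B(2)]
      by (auto simp: card_Diff_subset finite_subset)
    moreover have "card (A - Y) = r - card Y" "card Y \<le> r"
      using A fin matroidsD(3)[OF M A(1)] card_mono[OF fin(1) A(2)]
      by (auto simp: card_Diff_subset finite_subset)
    ultimately show ?thesis
      using assms(3) by linarith
  next
    case False
    then obtain y where "y \<in> Y - X" "y \<in> B"
      by blast
    then show ?thesis
      using B unfolding indep_def by blast
  qed
qed

text \<open>A largest independent set between \<open>X\<close> and \<open>G\<close> must reach the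
  rank of \<open>G\<close>: otherwise a basis attaining that rank would augment it inside
  \<open>G\<close>.\<close>

lemma indep_extend:
  assumes "indep M X" "X \<subseteq> G"
  shows "\<exists>B\<in>M. X \<subseteq> B \<and> card (B \<inter> G) = rank_of M G"
proof -
  define IS where "IS = {I. indep M I \<and> X \<subseteq> I \<and> I \<subseteq> G}"
  have bound: "card I \<le> rank_of M G" if "I \<in> IS" for I
    using that indep_card_le_rank_of unfolding IS_def by blast
  have "X \<in> IS"
    using assms unfolding IS_def by blast
  then obtain I where I: "I \<in> IS" and best: "\<And>J. J \<in> IS \<Longrightarrow> card J \<le> card I"
    using ex_has_greatest_nat[of "\<lambda>I. I \<in> IS" X card "Suc (rank_of M G)"] bound
    by (auto simp: less_Suc_eq_le)
  obtain A where A: "A \<in> M" "card (A \<inter> G) = rank_of M G"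
    using rank_of_attained by blast
  have "card I = rank_of M G"
  proof (rule ccontr)
    assume "card I \<noteq> rank_of M G"
    then have "card I < card (A \<inter> G)"
      using bound[OF I] A by simp
    moreover have "indep M (A \<inter> G)"
      using A unfolding indep_def by blast
    ultimately obtain y where y: "y \<in> A \<inter> G - I" "indep M (insert y I)"
      using indep_augment I unfolding IS_def by blast
    then have "insert y I \<in> IS"
      using I unfolding IS_def by blast
    moreover have "card (insert y I) = Suc (card I)"
      using y indep_finite I unfolding IS_def by auto
    ultimately show False
      using best by fastforce
  qed
  moreover obtain B where B: "B \<in> M" "I \<subseteq> B"
    using I unfolding IS_def indep_def by blast
  moreover have "card I \<le> card (B \<inter> G)"
    using I B matroidsD(4)[OF M B(1)] unfolding IS_def by (intro card_mono) auto
  ultimately have "card (B \<inter> G) = rank_of M G"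
    using card_inter_le_rank_of[OF B(1), of G] by linarith
  then show ?thesis
    using I B unfolding IS_def by blast
qed

text \<open>Induction removing the largest member \<open>G\<close>. From a basis that serves the
  rest, keep the part inside the smaller members and extend it to the rank of \<open>G\<close>. The
  counts in the smaller members cannot drop, and they were already maximal.\<close>

lemma chain_rank_of_attained:
  assumes "finite C" "chain\<^sub>\<subseteq> C"
  shows "\<exists>B\<in>M. \<forall>F\<in>C. card (B \<inter> F) = rank_of M F"
  using assms
proof (induction "card C" arbitrary: C)
  case 0
  then show ?case
    using matroidsD(1)[OF M] by auto
next
  case (Suc k)
  then have "C \<noteq> {}"
    by auto
  then obtain G where G: "G \<in> C" "\<And>F. F \<in> C \<Longrightarrow> F \<subseteq> G"
    using chain_Union_mem Suc.prems by blast
  have "chain\<^sub>\<subseteq> (C - {G})"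
    using Suc.prems unfolding chain_subset_def by blast
  moreover have "card (C - {G}) = k"
    using Suc.hyps(2) G Suc.prems by simp
  ultimately obtain B where B: "B \<in> M" "\<And>F. F \<in> C - {G} \<Longrightarrow> card (B \<inter> F) = rank_of M F"
    using Suc.hyps(1)[of "C - {G}"] Suc.prems by blast
  let ?X = "B \<inter> \<Union>(C - {G})"
  have "indep M ?X" "?X \<subseteq> G"
    using B G unfolding indep_def by blast+
  then obtain B' where B': "B' \<in> M" "?X \<subseteq> B'" "card (B' \<inter> G) = rank_of M G"
    using indep_extend by metis
  have "card (B' \<inter> F) = rank_of M F" if "F \<in> C - {G}" for F
  proof -
    have "card (B \<inter> F) \<le> card (B' \<inter> F)"
      using B' that matroidsD(4)[OF M B'(1)] by (intro card_mono) auto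
    then show ?thesis
      using B(2)[OF that] card_inter_le_rank_of[OF B'(1), of F] by linarith
  qed
  then show ?case
    using B' by blast
qed

text \<open>A single basis attains the ranks of the comparable sets \<open>X \<union> Y\<close> and
  \<open>X \<inter> Y\<close>; for it the inequality becomes modularity of cardinality.\<close>

lemma rank_of_submodular:
  "rank_of M (X \<union> Y) + rank_of M (X \<inter> Y) \<le> rank_of M X + rank_of M Y"
proof -
  have "chain\<^sub>\<subseteq> {X \<union> Y, X \<inter> Y}"
    unfolding chain_subset_def by blast
  then obtain B where B: "B \<in> M" "card (B \<inter> (X \<union> Y)) = rank_of M (X \<union> Y)"
    "card (B \<inter> (X \<inter> Y)) = rank_of M (X \<inter> Y)"
    using chain_rank_of_attained[of "{X \<union> Y, X \<inter> Y}"] by auto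
  have "card ((B \<inter> X) \<union> (B \<inter> Y)) + card ((B \<inter> X) \<inter> (B \<inter> Y)) = card (B \<inter> X) + card (B \<inter> Y)"
    using matroidsD(4)[OF M B(1)] by (intro card_Un_Int[symmetric]) auto
  moreover have "(B \<inter> X) \<union> (B \<inter> Y) = B \<inter> (X \<union> Y)" "(B \<inter> X) \<inter> (B \<inter> Y) = B \<inter> (X \<inter> Y)"
    by blast+
  ultimately show ?thesis
    using B card_inter_le_rank_of[OF B(1), of X] card_inter_le_rank_of[OF B(1), of Y] by simp
qed

end

subsection \<open>Integrality\<close>

lemma lookup_scaleR: "Poly_Mapping.lookup (c *\<^sub>R x) i = c *\<^sub>R Poly_Mapping.lookup x i"
proof -
  have "finite {i. c *\<^sub>R Poly_Mapping.lookup x i \<noteq> 0}"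
    by (rule finite_subset[OF _ finite_keys[of x]]) (auto simp: in_keys_iff)
  then show ?thesis
    by (simp add: scaleR_poly_mapping_def)
qed

lemma lookup_indicator_vec:
  "finite B \<Longrightarrow> Poly_Mapping.lookup (indicator_vec B) i = of_bool (i \<in> B)"
  by (simp add: indicator_vec_def lookup_sum lookup_single when_def of_bool_def sum.delta)

definition coord_sum :: "('i \<Rightarrow>\<^sub>0 real) \<Rightarrow> 'i set \<Rightarrow> real" where
  "coord_sum x F = (\<Sum>i\<in>F. Poly_Mapping.lookup x i)"

lemma coord_sum_add: "coord_sum (x + y) F = coord_sum x F + coord_sum y F"
  by (simp add: coord_sum_def lookup_add sum.distrib)

lemma coord_sum_diff: "coord_sum (x - y) F = coord_sum x F - coord_sum y F"
  by (simp add: coord_sum_def lookup_minus sum_subtractf)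

lemma coord_sum_scaleR: "coord_sum (c *\<^sub>R x) F = c * coord_sum x F"
  by (simp add: coord_sum_def lookup_scaleR sum_distrib_left)

lemma coord_sum_single: "finite F \<Longrightarrow> coord_sum (Poly_Mapping.single i c) F = of_bool (i \<in> F) * c"
  by (auto simp: coord_sum_def lookup_single when_def sum.delta)

lemma coord_sum_indicator_vec:
  "finite B \<Longrightarrow> finite F \<Longrightarrow> coord_sum (indicator_vec B) F = real (card (B \<inter> F))"
  by (simp add: coord_sum_def lookup_indicator_vec of_bool_def sum.If_cases Int_commute
      flip: sum.inter_filter)

lemmas coord_sum_simps = coord_sum_add coord_sum_diff coord_sum_scaleR

text \<open>For empty \<open>\<G>\<close> this is the hypersimplex. The family \<open>\<G>\<close>
  is a parameter because it is the full power set for a general matroid and a chain for a Schubert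
  matroid.\<close>

definition capped_polytope :: "nat \<Rightarrow> nat \<Rightarrow> nat set set \<Rightarrow> (nat set \<Rightarrow> nat) \<Rightarrow> (nat \<Rightarrow>\<^sub>0 real) set" where
  "capped_polytope r n \<G> g = {x. Poly_Mapping.keys x \<subseteq> {1..n} \<and>
     (\<forall>i. 0 \<le> Poly_Mapping.lookup x i \<and> Poly_Mapping.lookup x i \<le> 1) \<and>
     coord_sum x {1..n} = real r \<and> (\<forall>F\<in>\<G>. coord_sum x F \<le> real (g F))}"

text \<open>For constraint sets inside the ground set, these are the 0/1 points of
  \<open>capped_polytope\<close>.\<close>

definition capped_sets :: "nat \<Rightarrow> nat \<Rightarrow> nat set set \<Rightarrow> (nat set \<Rightarrow> nat) \<Rightarrow> nat set set" where
  "capped_sets r n \<G> g = {B. B \<subseteq> {1..n} \<and> card B = r \<and> (\<forall>F\<in>\<G>. card (B \<inter> F) \<le> g F)}"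

lemma convex_capped_polytope: "convex (capped_polytope r n \<G> g)"
proof (rule convexI)
  fix x y and u v :: real
  assume x: "x \<in> capped_polytope r n \<G> g" and y: "y \<in> capped_polytope r n \<G> g"
    and uv: "0 \<le> u" "0 \<le> v" "u + v = 1"
  let ?z = "u *\<^sub>R x + v *\<^sub>R y"
  have comb: "u * a + v * b \<le> c" if "a \<le> c" "b \<le> c" for a b c
    using uv that by (simp add: convex_bound_le)
  have "Poly_Mapping.keys ?z \<subseteq> Poly_Mapping.keys x \<union> Poly_Mapping.keys y"
    by (auto simp: in_keys_iff lookup_add lookup_scaleR)
  then have "Poly_Mapping.keys ?z \<subseteq> {1..n}"
    using x y unfolding capped_polytope_def by blast
  moreover have "u * real r + v * real r = real r"
    using uv by (simp flip: distrib_right)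
  ultimately show "?z \<in> capped_polytope r n \<G> g"
    using x y uv unfolding capped_polytope_def
    by (auto simp: lookup_add lookup_scaleR coord_sum_simps intro!: comb)
qed

text \<open>Mass moves from coordinate \<open>j\<close> to coordinate \<open>i\<close> until
  something stops it. By \<open>sep\<close> the tight constraints stay tight, so a positive move is
  possible. At the stop a fractional coordinate has become integral or a slack constraint has become
  tight, which lowers the measure behind the induction in
  \<open>capped_polytope_integral\<close>.\<close>

lemma shift_capped_polytope:
  assumes \<G>: "\<G> \<subseteq> Pow {1..n}" and x: "x \<in> capped_polytope r n \<G> g"
    and ij: "i \<in> {1..n}" "j \<in> {1..n}" "i \<noteq> j"
      "Poly_Mapping.lookup x i < 1" "0 < Poly_Mapping.lookup x i"
      "Poly_Mapping.lookup x j < 1" "0 < Poly_Mapping.lookup x j"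
    and sep: "\<And>F. F \<in> \<G> \<Longrightarrow> coord_sum x F = real (g F) \<Longrightarrow> i \<in> F \<longleftrightarrow> j \<in> F"
  defines "fr \<equiv> \<lambda>x. {i\<in>{1..n}. 0 < Poly_Mapping.lookup x i \<and> Poly_Mapping.lookup x i < 1}"
    and "sl \<equiv> \<lambda>x. {F\<in>\<G>. coord_sum x F < real (g F)}"
  shows "\<exists>e>0. x + e *\<^sub>R (Poly_Mapping.single i 1 - Poly_Mapping.single j 1) \<in> capped_polytope r n \<G> g \<and>
    card (fr (x + e *\<^sub>R (Poly_Mapping.single i 1 - Poly_Mapping.single j 1))) +
    card (sl (x + e *\<^sub>R (Poly_Mapping.single i 1 - Poly_Mapping.single j 1))) < card (fr x) + card (sl x)"
proof -
  define \<H> where "\<H> = {F\<in>\<G>. i \<in> F \<and> j \<notin> F}"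
  \<comment> \<open>The possible stops: coordinate \<open>i\<close> reaches 1, coordinate
    \<open>j\<close> reaches 0, or a constraint containing \<open>i\<close> but not \<open>j\<close>
    runs out of slack. No other constraint sum increases.\<close>
  define E where "E = {1 - Poly_Mapping.lookup x i, Poly_Mapping.lookup x j} \<union>
    (\<lambda>F. real (g F) - coord_sum x F) ` \<H>"
  define e where "e = Min E"
  let ?y = "x + e *\<^sub>R (Poly_Mapping.single i 1 - Poly_Mapping.single j 1)"
  have fin\<G>: "finite \<G>"
    using \<G> by (rule finite_subset) simp
  have finF: "finite F" if "F \<in> \<G>" for F
  proof (rule finite_subset)
    show "F \<subseteq> {1..n}"
      using \<G> that by blast
  qed simp
  have "finite \<H>"
    unfolding \<H>_def using fin\<G> by simp
  then have E: "finite E" "E \<noteq> {}"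
    unfolding E_def by auto
  have eE: "e \<in> E" and e_le: "\<And>d. d \<in> E \<Longrightarrow> e \<le> d"
    unfolding e_def using E by auto
  have xcap: "coord_sum x F \<le> real (g F)" if "F \<in> \<G>" for F
    using x that unfolding capped_polytope_def by blast
  have "d > 0" if "d \<in> E" for d
    using that ij sep xcap unfolding E_def \<H>_def by (force simp: less_le)
  then have e: "e > 0"
    using eE by blast
  have ylook: "Poly_Mapping.lookup ?y k = Poly_Mapping.lookup x k + e * (of_bool (k = i) - of_bool (k = j))" for k
    by (auto simp: lookup_add lookup_scaleR lookup_minus lookup_single when_def)
  have ysum: "coord_sum ?y F = coord_sum x F + e * (of_bool (i \<in> F) - of_bool (j \<in> F))" if "finite F" for F
    using that by (simp add: coord_sum_simps coord_sum_single)
  have e1: "e \<le> 1 - Poly_Mapping.lookup x i" "e \<le> Poly_Mapping.lookup x j"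
    by (rule e_le, simp add: E_def)+
  have e2: "e \<le> real (g F) - coord_sum x F" if "F \<in> \<H>" for F
    using that by (intro e_le) (simp add: E_def)
  have ycap: "coord_sum ?y F \<le> real (g F)" if "F \<in> \<G>" for F
    using ysum[OF finF[OF that]] e e2[of F] xcap[OF that] that unfolding \<H>_def
    by (auto simp: of_bool_def split: if_splits)
  have x01: "0 \<le> Poly_Mapping.lookup x k" "Poly_Mapping.lookup x k \<le> 1" for k
    using x unfolding capped_polytope_def by auto
  have y01: "0 \<le> Poly_Mapping.lookup ?y k" "Poly_Mapping.lookup ?y k \<le> 1" for k
    using e e1 x01[of k] ij unfolding ylook by (auto simp: of_bool_def)
  have "Poly_Mapping.keys ?y \<subseteq> {1..n}"
    using x ij unfolding capped_polytope_def
    by (auto simp: in_keys_iff subset_iff ylook of_bool_def split: if_splits)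
  moreover have "coord_sum ?y {1..n} = real r"
    using x ij unfolding capped_polytope_def by (subst ysum) auto
  ultimately have y: "?y \<in> capped_polytope r n \<G> g"
    using ycap y01 unfolding capped_polytope_def by blast
  have fr_sub: "fr ?y \<subseteq> fr x"
    using ij unfolding fr_def by (auto simp: ylook of_bool_def split: if_splits)
  have sl_sub: "sl ?y \<subseteq> sl x"
    unfolding sl_def using sep xcap ysum finF by (force simp: less_le)
  have fins: "finite (fr x)" "finite (sl x)"
    unfolding fr_def sl_def using fin\<G> by auto
  consider "e = 1 - Poly_Mapping.lookup x i" | "e = Poly_Mapping.lookup x j"
    | F where "F \<in> \<H>" "e = real (g F) - coord_sum x F"
    using eE unfolding E_def by blast
  then have "fr ?y \<subset> fr x \<or> sl ?y \<subset> sl x"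
  proof cases
    case 1
    then have "Poly_Mapping.lookup ?y i = 1"
      using ij by (subst ylook) simp
    then have "i \<in> fr x - fr ?y"
      using ij unfolding fr_def by simp
    then show ?thesis
      using fr_sub by blast
  next
    case 2
    then have "Poly_Mapping.lookup ?y j = 0"
      using ij by (subst ylook) simp
    then have "j \<in> fr x - fr ?y"
      using ij unfolding fr_def by simp
    then show ?thesis
      using fr_sub by blast
  next
    case 3
    then have "F \<in> \<G>" "i \<in> F" "j \<notin> F"
      unfolding \<H>_def by auto
    then have "F \<in> sl x - sl ?y"
      using 3 e finF ysum unfolding sl_def by auto
    then show ?thesis
      using sl_sub by blast
  qed
  then have "card (fr ?y) + card (sl ?y) < card (fr x) + card (sl x)"
  proof
    assume "fr ?y \<subset> fr x"
    from psubset_card_mono[OF fins(1) this] card_mono[OF fins(2) sl_sub] show ?thesis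
      by linarith
  next
    assume "sl ?y \<subset> sl x"
    from psubset_card_mono[OF fins(2) this] card_mono[OF fins(1) fr_sub] show ?thesis
      by linarith
  qed
  then show ?thesis
    using y e by blast
qed

text \<open>A point without fractional coordinates is an indicator vector. Any other point lies
  between two points with a smaller total of fractional coordinates and slack constraints, reached
  by moving mass between two coordinates in both directions. Closure of the tight sets under
  intersection provides two coordinates that no tight set separates.\<close>

lemma capped_polytope_integral:
  assumes \<G>: "\<G> \<subseteq> Pow {1..n}" "{1..n} \<in> \<G>" "g {1..n} = r"
    and tight: "\<And>x F G. x \<in> capped_polytope r n \<G> g \<Longrightarrow> F \<in> \<G> \<Longrightarrow> G \<in> \<G> \<Longrightarrow>
      coord_sum x F = real (g F) \<Longrightarrow> coord_sum x G = real (g G) \<Longrightarrow>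
      F \<inter> G \<in> \<G> \<and> coord_sum x (F \<inter> G) = real (g (F \<inter> G))"
  shows "capped_polytope r n \<G> g = convex hull (indicator_vec ` capped_sets r n \<G> g)"
proof
  have finF: "finite F" if "F \<in> \<G>" for F
  proof (rule finite_subset)
    show "F \<subseteq> {1..n}"
      using \<G> that by blast
  qed simp
  show "convex hull (indicator_vec ` capped_sets r n \<G> g) \<subseteq> capped_polytope r n \<G> g"
  proof (intro hull_minimal convex_capped_polytope image_subsetI)
    fix B assume B: "B \<in> capped_sets r n \<G> g"
    then have finB: "finite B" and "B \<inter> {1..n} = B"
      unfolding capped_sets_def by (auto intro: finite_subset)
    then show "indicator_vec B \<in> capped_polytope r n \<G> g"
      using B finF unfolding capped_sets_def capped_polytope_def
      by (auto simp: coord_sum_indicator_vec lookup_indicator_vec in_keys_iff)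
  qed
  define fr where "fr = (\<lambda>x. {i\<in>{1..n}. 0 < Poly_Mapping.lookup x i \<and> Poly_Mapping.lookup x i < (1::real)})"
  define sl where "sl = (\<lambda>x. {F\<in>\<G>. coord_sum x F < real (g F)})"
  show "capped_polytope r n \<G> g \<subseteq> convex hull (indicator_vec ` capped_sets r n \<G> g)"
  proof
    fix x assume "x \<in> capped_polytope r n \<G> g"
    then show "x \<in> convex hull (indicator_vec ` capped_sets r n \<G> g)"
    proof (induction "card (fr x) + card (sl x)" arbitrary: x rule: less_induct)
      case less
      note x = less.prems
      have x01: "0 \<le> Poly_Mapping.lookup x k" "Poly_Mapping.lookup x k \<le> 1" for k
        using x unfolding capped_polytope_def by auto
      have keys: "Poly_Mapping.lookup x k = 0" if "k \<notin> {1..n}" for k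
        using x that unfolding capped_polytope_def by (auto simp: in_keys_iff)
      have xr: "coord_sum x {1..n} = real r"
        using x unfolding capped_polytope_def by blast
      have int: "Poly_Mapping.lookup x k = 0 \<or> Poly_Mapping.lookup x k = 1" if "k \<notin> fr x" for k
        using that x01[of k] keys[of k] unfolding fr_def by (auto simp: less_le)
      show ?case
      proof (cases "fr x = {}")
        case True
        define B where "B = {k. Poly_Mapping.lookup x k = 1}"
        have B: "B \<subseteq> {1..n}"
          using keys unfolding B_def by force
        then have finB: "finite B"
          using finite_subset by blast
        have "Poly_Mapping.lookup x k = Poly_Mapping.lookup (indicator_vec B) k" for k
          unfolding lookup_indicator_vec[OF finB] using int[of k] True by (auto simp: B_def)
        then have xB: "x = indicator_vec B"
          by (rule poly_mapping_eqI)
        have "B \<inter> {1..n} = B"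
          using B by blast
        then have "card B = r"
          using xr by (simp add: xB coord_sum_indicator_vec finB)
        moreover have "card (B \<inter> F) \<le> g F" if "F \<in> \<G>" for F
          using x that finF[OF that] unfolding capped_polytope_def xB
          by (auto simp: coord_sum_indicator_vec finB)
        ultimately have "B \<in> capped_sets r n \<G> g"
          using B unfolding capped_sets_def by blast
        then show ?thesis
          unfolding xB by (intro hull_inc) blast
      next
        case False
        \<comment> \<open>The tight sets that contain a fractional coordinate. A minimal one lies
          inside every tight set that meets it in a fractional coordinate, so no tight set separates
          its fractional coordinates. The ground set is a member, so a minimal one exists.\<close>
        define \<T> where "\<T> = {F\<in>\<G>. coord_sum x F = real (g F) \<and> F \<inter> fr x \<noteq> {}}"
        have "fr x \<subseteq> {1..n}"
          unfolding fr_def by blast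
        then have "{1..n} \<in> \<T>"
          using False xr \<G> unfolding \<T>_def by auto
        moreover have "finite \<T>"
          using \<G> unfolding \<T>_def by (auto intro: finite_subset)
        ultimately obtain T where T: "T \<in> \<T>" and min: "\<And>F. F \<in> \<T> \<Longrightarrow> F \<subseteq> T \<Longrightarrow> F = T"
          using finite_has_minimal[of \<T>] by blast
        then obtain i where i: "i \<in> T" "i \<in> fr x" and TG: "T \<in> \<G>"
          unfolding \<T>_def by blast
        \<comment> \<open>A tight set has an integral coordinate sum, so it cannot contain exactly
          one fractional coordinate.\<close>
        have "\<exists>j\<in>T \<inter> fr x. j \<noteq> i"
        proof (rule ccontr)
          assume *: "\<not> ?thesis"
          have "coord_sum x T = Poly_Mapping.lookup x i + (\<Sum>k\<in>T - {i}. Poly_Mapping.lookup x k)"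
            unfolding coord_sum_def using i finF[OF TG] by (simp add: sum.remove)
          moreover have "(\<Sum>k\<in>T - {i}. Poly_Mapping.lookup x k) \<in> \<int>"
          proof (rule Ints_sum)
            fix k assume "k \<in> T - {i}"
            then have "k \<notin> fr x"
              using * by blast
            then show "Poly_Mapping.lookup x k \<in> \<int>"
              using int[of k] by auto
          qed
          moreover have "coord_sum x T \<in> \<int>"
            using T unfolding \<T>_def by auto
          ultimately have "Poly_Mapping.lookup x i \<in> \<int>"
            by (metis Ints_diff add_diff_cancel_right')
          moreover have "0 < Poly_Mapping.lookup x i" "Poly_Mapping.lookup x i < 1"
            using i unfolding fr_def by auto
          ultimately show False
            by (auto elim!: Ints_cases)
        qed
        then obtain j where j: "j \<in> T" "j \<in> fr x" "j \<noteq> i"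
          by blast
        have sep: "i \<in> F \<longleftrightarrow> j \<in> F" if F: "F \<in> \<G>" "coord_sum x F = real (g F)" for F
        proof -
          have "F \<inter> T \<in> \<G> \<and> coord_sum x (F \<inter> T) = real (g (F \<inter> T))"
            using tight[OF x F(1) TG F(2)] T unfolding \<T>_def by blast
          then have "F \<inter> T \<in> \<T>" if "F \<inter> T \<inter> fr x \<noteq> {}"
            using that unfolding \<T>_def by blast
          then have "T \<subseteq> F" if "F \<inter> T \<inter> fr x \<noteq> {}"
            using that min by blast
          then show ?thesis
            using i j by blast
        qed
        let ?d = "\<lambda>i j. Poly_Mapping.single i (1::real) - Poly_Mapping.single j 1"
        have ij: "i \<in> {1..n}" "j \<in> {1..n}" "Poly_Mapping.lookup x i < 1" "0 < Poly_Mapping.lookup x i"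
          "Poly_Mapping.lookup x j < 1" "0 < Poly_Mapping.lookup x j"
          using i j unfolding fr_def by auto
        obtain e where e: "e > 0" "x + e *\<^sub>R ?d i j \<in> capped_polytope r n \<G> g"
          "card (fr (x + e *\<^sub>R ?d i j)) + card (sl (x + e *\<^sub>R ?d i j)) < card (fr x) + card (sl x)"
          using shift_capped_polytope[OF \<G>(1) x ij(1,2) j(3)[symmetric] ij(3-6)] sep
          unfolding fr_def sl_def by blast
        obtain e' where e': "e' > 0" "x + e' *\<^sub>R ?d j i \<in> capped_polytope r n \<G> g"
          "card (fr (x + e' *\<^sub>R ?d j i)) + card (sl (x + e' *\<^sub>R ?d j i)) < card (fr x) + card (sl x)"
          using shift_capped_polytope[OF \<G>(1) x ij(2,1) j(3) ij(5,6,3,4)] sep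
          unfolding fr_def sl_def by blast
        let ?H = "convex hull (indicator_vec ` capped_sets r n \<G> g)"
        have H: "x + e *\<^sub>R ?d i j \<in> ?H" "x + e' *\<^sub>R ?d j i \<in> ?H"
          using less.hyps[OF e(3,2)] less.hyps[OF e'(3,2)] by auto
        \<comment> \<open>The weight for which the two opposite displacements cancel.\<close>
        define u where "u = e' / (e + e')"
        have "0 \<le> u" "u \<le> 1" and ue: "u * e - (1 - u) * e' = 0"
          using e(1) e'(1) unfolding u_def by (auto simp: field_simps)
        moreover have "u *\<^sub>R (x + e *\<^sub>R ?d i j) + (1 - u) *\<^sub>R (x + e' *\<^sub>R ?d j i) =
            x + (u * e - (1 - u) * e') *\<^sub>R ?d i j"
          by (simp add: algebra_simps)
        ultimately have "u *\<^sub>R (x + e *\<^sub>R ?d i j) + (1 - u) *\<^sub>R (x + e' *\<^sub>R ?d j i) = x"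
          by simp
        then show ?thesis
          using convexD_alt[OF convex_convex_hull H(2,1), of u] \<open>0 \<le> u\<close> \<open>u \<le> 1\<close>
          by (simp add: add.commute)
      qed
    qed
  qed
qed

subsection \<open>Rank constraints along a chain\<close>

text \<open>Coordinate sums are modular and the rank is submodular, so tightness at two sets passes
  to their intersection and integrality applies. The 0/1 points are the bases: for \<open>B\<close>
  of size \<open>r\<close>, the inequality at \<open>B\<close> itself forces full rank.\<close>

lemma base_polytope_eq_capped_polytope:
  assumes M: "M \<in> matroids r n"
  shows "base_polytope M = capped_polytope r n (Pow {1..n}) (rank_of M)"
proof -
  have "capped_sets r n (Pow {1..n}) (rank_of M) = M"
  proof (intro set_eqI iffI)
    fix B assume "B \<in> capped_sets r n (Pow {1..n}) (rank_of M)"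
    then have "B \<subseteq> {1..n}" "card B = r" "card (B \<inter> B) \<le> rank_of M B"
      unfolding capped_sets_def by blast+
    then show "B \<in> M"
      using basis_iff_rank_of[OF M] by simp
  next
    fix B assume "B \<in> M"
    then show "B \<in> capped_sets r n (Pow {1..n}) (rank_of M)"
      using card_inter_le_rank_of[OF M] matroidsD(2,3)[OF M] unfolding capped_sets_def by blast
  qed
  moreover have "capped_polytope r n (Pow {1..n}) (rank_of M) =
    convex hull (indicator_vec ` capped_sets r n (Pow {1..n}) (rank_of M))"
  proof (rule capped_polytope_integral)
    fix x F G
    assume x: "x \<in> capped_polytope r n (Pow {1..n}) (rank_of M)"
      and FG: "F \<in> Pow {1..n}" "G \<in> Pow {1..n}"
      and t: "coord_sum x F = real (rank_of M F)" "coord_sum x G = real (rank_of M G)"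
    have "finite F" "finite G"
      using FG finite_subset by blast+
    then have "coord_sum x (F \<union> G) + coord_sum x (F \<inter> G) = coord_sum x F + coord_sum x G"
      unfolding coord_sum_def by (rule sum.union_inter)
    moreover have "F \<union> G \<in> Pow {1..n}" "F \<inter> G \<in> Pow {1..n}"
      using FG by auto
    then have "coord_sum x (F \<union> G) \<le> real (rank_of M (F \<union> G))"
      "coord_sum x (F \<inter> G) \<le> real (rank_of M (F \<inter> G))"
      using x unfolding capped_polytope_def by blast+
    moreover have "real (rank_of M (F \<union> G)) + real (rank_of M (F \<inter> G)) \<le>
        real (rank_of M F) + real (rank_of M G)"
      using rank_of_submodular[OF M, of F G] by linarith
    ultimately have "coord_sum x (F \<inter> G) = real (rank_of M (F \<inter> G))"
      using t by linarith
    then show "F \<inter> G \<in> Pow {1..n} \<and> coord_sum x (F \<inter> G) = real (rank_of M (F \<inter> G))"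
      using FG by blast
  qed (use rank_of_ground[OF M] in auto)
  ultimately show ?thesis
    unfolding base_polytope_def by simp
qed

section \<open>The matroid cut out by a chain of caps\<close>

context
  fixes r n :: nat and C :: "nat set set" and g :: "nat set \<Rightarrow> nat"
  assumes C: "C \<subseteq> Pow {1..n}" "chain\<^sub>\<subseteq> C" "{1..n} \<in> C" "g {1..n} = r"
    and nonempty: "capped_sets r n C g \<noteq> {}"
begin

lemma finite_constraints: "finite C"
  using C(1) by (rule finite_subset) simp

text \<open>In a chain the intersection of two tight sets is one of them, so the closure hypothesis
  of \<open>capped_polytope_integral\<close> is immediate.\<close>

lemma base_polytope_capped_sets: "base_polytope (capped_sets r n C g) = capped_polytope r n C g"
  unfolding base_polytope_def
proof (rule capped_polytope_integral[symmetric])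
  fix x F G assume FG: "F \<in> C" "G \<in> C"
    "coord_sum x F = real (g F)" "coord_sum x G = real (g G)"
  then have "F \<inter> G = F \<or> F \<inter> G = G"
    using C(2) unfolding chain_subset_def by blast
  then show "F \<inter> G \<in> C \<and> coord_sum x (F \<inter> G) = real (g (F \<inter> G))"
    using FG by auto
qed (use C in auto)

lemma capped_setsD:
  assumes "B \<in> capped_sets r n C g"
  shows "B \<subseteq> {1..n}" "card B = r" "finite B" "\<And>F. F \<in> C \<Longrightarrow> card (B \<inter> F) \<le> g F"
  using assms finite_subset unfolding capped_sets_def by auto

text \<open>The union of a nonempty family of tight sets in the chain is its largest member, so
  \<open>X\<close> attains the cap there while \<open>B\<close> obeys it. The exchange and the
  augmentation argument below both count with this.\<close>

lemma Union_tight: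
  assumes "\<T> \<subseteq> {F\<in>C. card (X \<inter> F) = g F}" "B \<in> capped_sets r n C g"
  shows "card (B \<inter> \<Union>\<T>) \<le> card (X \<inter> \<Union>\<T>)"
proof (cases "\<T> = {}")
  case False
  have "finite \<T>" "chain\<^sub>\<subseteq> \<T>"
    using assms(1) finite_constraints C(2) by (auto intro: finite_subset chain_subset_mono)
  then have "\<Union>\<T> \<in> {F\<in>C. card (X \<inter> F) = g F}"
    using chain_Union_mem False assms(1) by blast
  then show ?thesis
    using capped_setsD(4)[OF assms(2)] by simp
qed simp

text \<open>To exchange \<open>x\<close>, take \<open>y\<close> outside all tight sets of
  \<open>A\<close> that miss \<open>x\<close>. If their union contained \<open>B - A\<close>, then
  outside the union \<open>B\<close> would have only elements of \<open>A - {x}\<close>, and by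
  \<open>Union_tight\<close> \<open>B\<close> would be smaller than \<open>A\<close>. Such a
  \<open>y\<close> overfills no cap: a set containing \<open>x\<close> loses \<open>x\<close>, and a
  set containing \<open>y\<close> but not \<open>x\<close> has room.\<close>

lemma capped_sets_matroid: "capped_sets r n C g \<in> matroids r n"
proof -
  have "\<exists>y\<in>B - A. insert y (A - {x}) \<in> capped_sets r n C g"
    if AB: "A \<in> capped_sets r n C g" "B \<in> capped_sets r n C g" and x: "x \<in> A" "x \<notin> B" for A B x
  proof -
    note A = capped_setsD[OF AB(1)] and B = capped_setsD[OF AB(2)]
    define \<T> where "\<T> = {F\<in>C. card (A \<inter> F) = g F \<and> x \<notin> F}"
    have le: "card (B \<inter> \<Union>\<T>) \<le> card (A \<inter> \<Union>\<T>)"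
      using AB(2) by (intro Union_tight) (auto simp: \<T>_def)
    have "x \<in> A - \<Union>\<T>"
      using x unfolding \<T>_def by blast
    then have lt: "card (A - \<Union>\<T> - {x}) < card (A - \<Union>\<T>)"
      using A(3) by (intro psubset_card_mono) auto
    have "\<not> B - A \<subseteq> \<Union>\<T>"
    proof
      assume "B - A \<subseteq> \<Union>\<T>"
      then have "card (B - \<Union>\<T>) \<le> card (A - \<Union>\<T> - {x})"
        using A(3) x by (intro card_mono) auto
      then have "card (B - \<Union>\<T>) + card (B \<inter> \<Union>\<T>) < card (A - \<Union>\<T>) + card (A \<inter> \<Union>\<T>)"
        using le lt by linarith
      then show False
        using A(2,3) B(2,3) card_Int_Diff[of A "\<Union>\<T>"] card_Int_Diff[of B "\<Union>\<T>"] by simp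
    qed
    then obtain y where y: "y \<in> B - A" "y \<notin> \<Union>\<T>"
      by blast
    let ?A' = "insert y (A - {x})"
    have "card ?A' = r"
    proof -
      have "card ?A' = Suc (card (A - {x}))"
        using y A(3) by simp
      also have "\<dots> = card A"
        by (rule card_Suc_Diff1[OF A(3) x(1)])
      finally show ?thesis
        using A(2) by simp
    qed
    moreover have "card (?A' \<inter> F) \<le> g F" if F: "F \<in> C" for F
    proof (cases "y \<in> F")
      case False
      then have "card (?A' \<inter> F) \<le> card (A \<inter> F)"
        using A(3) by (intro card_mono) auto
      then show ?thesis
        using A(4)[OF F] by linarith
    next
      case True
      show ?thesis
      proof (cases "x \<in> F")
        case True
        have "card (?A' \<inter> F) \<le> card (insert y ((A \<inter> F) - {x}))"
          using A(3) by (intro card_mono) auto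
        also have "\<dots> = Suc (card ((A \<inter> F) - {x}))"
          using A(3) y by simp
        also have "\<dots> = card (A \<inter> F)"
          using A(3) x True by (intro card_Suc_Diff1) auto
        finally show ?thesis
          using A(4)[OF F] by linarith
      next
        case False
        then have "card (A \<inter> F) \<noteq> g F"
          using y \<open>y \<in> F\<close> F unfolding \<T>_def by blast
        moreover have "card (?A' \<inter> F) \<le> card (insert y (A \<inter> F))"
          using A(3) by (intro card_mono) auto
        moreover have "card (insert y (A \<inter> F)) = Suc (card (A \<inter> F))"
          using A(3) y by simp
        ultimately show ?thesis
          using A(4)[OF F] by linarith
      qed
    qed
    moreover have "?A' \<subseteq> {1..n}"
      using A(1) B(1) y by blast
    ultimately show ?thesis
      using y unfolding capped_sets_def by blast
  qed
  then show ?thesis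
    using nonempty capped_setsD(1,2) unfolding matroids_def by blast
qed

text \<open>Induction on the number of missing elements. While \<open>X\<close> has fewer than
  \<open>r\<close> elements, \<open>Union_tight\<close> gives a basis an element outside
  \<open>X\<close> and outside all tight sets of \<open>X\<close>, which can be added.\<close>

lemma indep_capped_sets:
  assumes "X \<subseteq> {1..n}" "\<And>F. F \<in> C \<Longrightarrow> card (X \<inter> F) \<le> g F"
  shows "indep (capped_sets r n C g) X"
  using assms
proof (induction "r - card X" arbitrary: X rule: less_induct)
  case less
  have finX: "finite X"
    using less.prems(1) finite_subset by blast
  have "X \<inter> {1..n} = X"
    using less.prems(1) by blast
  then have le: "card X \<le> r"
    using less.prems(2)[OF C(3)] C(4) by simp
  show ?case
  proof (cases "card X = r")
    case True
    then have "X \<in> capped_sets r n C g"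
      using less.prems unfolding capped_sets_def by blast
    then show ?thesis
      unfolding indep_def by blast
  next
    case False
    obtain B where BN: "B \<in> capped_sets r n C g"
      using nonempty by blast
    note B = capped_setsD[OF BN]
    define \<T> where "\<T> = {F\<in>C. card (X \<inter> F) = g F}"
    have "card (B \<inter> \<Union>\<T>) \<le> card (X \<inter> \<Union>\<T>)"
      using BN by (intro Union_tight) (auto simp: \<T>_def)
    then have "card (X - \<Union>\<T>) < card (B - \<Union>\<T>)"
      using card_Int_Diff[OF finX, of "\<Union>\<T>"] card_Int_Diff[OF B(3), of "\<Union>\<T>"] B(2) False le by linarith
    then have "\<not> B - \<Union>\<T> \<subseteq> X - \<Union>\<T>"
      using finX card_mono[of "X - \<Union>\<T>" "B - \<Union>\<T>"] by fastforce
    then obtain y where y: "y \<in> B" "y \<notin> \<Union>\<T>" "y \<notin> X"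
      by blast
    have "card (insert y X \<inter> F) \<le> g F" if F: "F \<in> C" for F
    proof (cases "y \<in> F")
      case True
      then have "card (X \<inter> F) \<noteq> g F"
        using y F unfolding \<T>_def by blast
      moreover have "insert y X \<inter> F = insert y (X \<inter> F)"
        using True by blast
      ultimately show ?thesis
        using less.prems(2)[OF F] y finX by simp
    next
      case False
      then show ?thesis
        using less.prems(2)[OF F] by simp
    qed
    moreover have "insert y X \<subseteq> {1..n}"
      using y B(1) less.prems(1) by blast
    moreover have "r - card (insert y X) < r - card X"
      using y finX False le by simp
    ultimately have "indep (capped_sets r n C g) (insert y X)"
      using less.hyps by blast
    then show ?thesis
      unfolding indep_def by blast
  qed
qed

text \<open>A circuit \<open>D\<close> inside the cyclic flat \<open>Z\<close> overfills the cap of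
  some \<open>F\<close>. Already \<open>D \<inter> F\<close> is dependent, so \<open>D\<close> lies
  in \<open>F\<close>. Deleting one element of \<open>D\<close> shows that
  \<open>Z \<inter> F\<close> has rank at least \<open>g F\<close>, so by submodularity the flat
  \<open>Z\<close> absorbs \<open>F\<close>. Hence \<open>Z\<close> is a union of members of the
  chain, possibly of none.\<close>

lemma cyclic_flats_capped_sets: "cyclic_flats n (capped_sets r n C g) \<subseteq> insert {} C"
proof
  let ?N = "capped_sets r n C g"
  note N = capped_sets_matroid
  fix Z assume "Z \<in> cyclic_flats n ?N"
  then obtain \<C> where Z: "Z \<in> flats n ?N" and \<C>: "\<C> \<subseteq> circuits n ?N" "Z = \<Union>\<C>"
    unfolding cyclic_flats_def by blast
  have "\<exists>F\<in>C. D \<subseteq> F \<and> F \<subseteq> Z" if "D \<in> \<C>" for D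
  proof -
    have D: "D \<subseteq> {1..n}" "\<not> indep ?N D" "\<And>D'. D' \<subset> D \<Longrightarrow> indep ?N D'" "D \<subseteq> Z"
      using that \<C> unfolding circuits_def by auto
    obtain F where F: "F \<in> C" "g F < card (D \<inter> F)"
      using indep_capped_sets[OF D(1)] D(2) by force
    have "\<not> indep ?N (D \<inter> F)"
    proof
      assume "indep ?N (D \<inter> F)"
      then obtain B where B: "B \<in> ?N" "D \<inter> F \<subseteq> B"
        unfolding indep_def by blast
      have "card (D \<inter> F) \<le> card (B \<inter> F)"
        using B capped_setsD(3)[OF B(1)] by (intro card_mono) auto
      then show False
        using capped_setsD(4)[OF B(1) F(1)] F(2) by linarith
    qed
    then have DF: "D \<inter> F = D"
      using D(3)[of "D \<inter> F"] by blast
    then obtain d where d: "d \<in> D"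
      using F(2) by (cases "D = {}") auto
    have "finite D"
      using D(1) finite_subset by blast
    then have "g F \<le> card (D - {d})"
      using F(2) d DF by simp
    also have "\<dots> \<le> rank_of ?N (Z \<inter> F)"
      using d D(3)[of "D - {d}"] D(4) DF by (intro indep_card_le_rank_of[OF N]) auto
    finally have "g F \<le> rank_of ?N (Z \<inter> F)" .
    moreover have "rank_of ?N F \<le> g F"
      using capped_setsD(4)[OF _ F(1)] by (rule rank_of_le[OF N])
    ultimately have *: "rank_of ?N (Z \<union> F) \<le> rank_of ?N Z"
      using rank_of_submodular[OF N, of Z F] by linarith
    have "F \<subseteq> Z"
    proof
      fix e assume e: "e \<in> F"
      show "e \<in> Z"
      proof (rule ccontr)
        assume "e \<notin> Z"
        then have "rank_of ?N Z < rank_of ?N (insert e Z)"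
          using Z e F(1) C(1) unfolding flats_def by blast
        also have "\<dots> \<le> rank_of ?N (Z \<union> F)"
          using e by (intro rank_of_mono[OF N]) auto
        finally show False
          using * by simp
      qed
    qed
    then show ?thesis
      using F(1) DF by blast
  qed
  then have eq: "Z = \<Union>{F\<in>C. F \<subseteq> Z}"
    using \<C>(2) by blast
  have "{F\<in>C. F \<subseteq> Z} \<noteq> {} \<Longrightarrow> \<Union>{F\<in>C. F \<subseteq> Z} \<in> {F\<in>C. F \<subseteq> Z}"
    using finite_constraints C(2) by (intro chain_Union_mem) (auto intro: chain_subset_mono)
  then show "Z \<in> insert {} C"
    using eq by (cases "{F\<in>C. F \<subseteq> Z} = {}") auto
qed

lemma capped_sets_schubert: "capped_sets r n C g \<in> schubert_matroids r n"
proof -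
  have "chain\<^sub>\<subseteq> (insert {} C)"
    using C(2) by (intro chain_subset_insert) auto
  then show ?thesis
    using capped_sets_matroid cyclic_flats_capped_sets chain_subset_mono
    unfolding schubert_matroids_def by blast
qed

end

subsection \<open>Expansion into Schubert matroids\<close>

definition toggle :: "'a set \<Rightarrow> 'a \<Rightarrow> 'a set" where
  "toggle C e = (if e \<in> C then C - {e} else insert e C)"

text \<open>A sign-reversing involution: \<open>inv\<close> says that after toggling the same
  element is selected again.\<close>

lemma sum_sign_toggle_eq_0:
  assumes fin: "\<And>C. C \<in> \<A> \<Longrightarrow> finite C"
    and closed: "\<And>C. C \<in> \<A> \<Longrightarrow> toggle C (t C) \<in> \<A>"
    and inv: "\<And>C. C \<in> \<A> \<Longrightarrow> t (toggle C (t C)) = t C"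
  shows "(\<Sum>C\<in>\<A>. (-1) ^ card C) = (0::int)"
proof -
  have involution: "toggle (toggle C (t C)) (t (toggle C (t C))) = C" if "C \<in> \<A>" for C
    unfolding inv[OF that] by (auto simp: toggle_def)
  have "(\<Sum>C\<in>\<A>. (-1) ^ card C) = (\<Sum>C\<in>\<A>. - ((-1) ^ card C) :: int)"
  proof (rule sum.reindex_bij_witness[of _ "\<lambda>C. toggle C (t C)" "\<lambda>C. toggle C (t C)"])
    fix C assume C: "C \<in> \<A>"
    have "Suc (card (toggle C (t C))) = card C \<or> card (toggle C (t C)) = Suc (card C)"
      using card_Suc_Diff1[OF fin[OF C], of "t C"] card_insert_disjoint[OF fin[OF C], of "t C"]
      unfolding toggle_def by (cases "t C \<in> C") auto
    moreover have "(-1) ^ Suc k = - ((-1) ^ k :: int)" for k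
      by simp
    ultimately show "- ((-1) ^ card (toggle C (t C))) = ((-1) ^ card C :: int)"
      by (metis minus_minus)
  qed (use closed involution in auto)
  then show ?thesis
    by (simp add: sum_negf)
qed

lemma sum_sign_Pow:
  assumes "finite A"
  shows "(\<Sum>C\<in>Pow A. (-1) ^ card C) = (of_bool (A = {}) :: int)"
proof (cases "A = {}")
  case False
  then obtain a where "a \<in> A"
    by blast
  then have "(\<Sum>C\<in>Pow A. (-1) ^ card C) = (0::int)"
    using assms by (intro sum_sign_toggle_eq_0[where t = "\<lambda>_. a"])
      (auto simp: toggle_def intro: finite_subset)
  then show ?thesis
    using False by simp
qed simp

text \<open>A family closed under joining with one of its members \<open>F0\<close> has a contractible order complex.\<close>

lemma sum_sign_chains_eq_0:
  fixes V :: "'a set set"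
  assumes fin: "finite V" and F0: "F0 \<in> V" and join: "\<And>G. G \<in> V \<Longrightarrow> F0 \<union> G \<in> V"
  shows "(\<Sum>C\<in>{C. C \<subseteq> V \<and> chain\<^sub>\<subseteq> C}. (-1) ^ card C) = (0::int)"
proof (rule sum_sign_toggle_eq_0)
  \<comment> \<open>\<open>t C\<close> joins \<open>F0\<close> with the largest member of
    \<open>C\<close> not containing \<open>F0\<close>, if there is one. It is comparable with every
    member of \<open>C\<close>. As it contains \<open>F0\<close>, toggling it leaves the members
    that determine it untouched.\<close>
  define t where "t = (\<lambda>C :: 'a set set. F0 \<union> \<Union>{G\<in>C. \<not> F0 \<subseteq> G})"
  have t_eq: "t D = F0 \<union> \<Union>{G\<in>D. \<not> F0 \<subseteq> G}" for D
    by (simp add: t_def)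
  fix C assume "C \<in> {C. C \<subseteq> V \<and> chain\<^sub>\<subseteq> C}"
  then have C: "C \<subseteq> V" "chain\<^sub>\<subseteq> C"
    by auto
  show finC: "finite C"
    using C(1) fin by (rule finite_subset)
  have tV: "t C \<in> V"
  proof (cases "{G\<in>C. \<not> F0 \<subseteq> G} = {}")
    case True
    then show ?thesis
      unfolding t_def True using F0 by simp
  next
    case False
    then have "\<Union>{G\<in>C. \<not> F0 \<subseteq> G} \<in> {G\<in>C. \<not> F0 \<subseteq> G}"
      using finC C(2) by (intro chain_Union_mem) (auto intro: chain_subset_mono)
    then show ?thesis
      using join C(1) unfolding t_def by blast
  qed
  have cmp: "F \<subseteq> t C \<or> t C \<subseteq> F" if F: "F \<in> C" for F
  proof (cases "F0 \<subseteq> F")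
    case True
    have "G \<subseteq> F" if "G \<in> C" "\<not> F0 \<subseteq> G" for G
      using C(2) F that True unfolding chain_subset_def by blast
    then show ?thesis
      using True unfolding t_def by blast
  next
    case False
    then show ?thesis
      using F unfolding t_def by blast
  qed
  show "toggle C (t C) \<in> {C. C \<subseteq> V \<and> chain\<^sub>\<subseteq> C}"
    using C tV cmp chain_subset_insert[OF C(2), of "t C"]
    by (auto simp: toggle_def intro: chain_subset_mono)
  have "{G \<in> toggle C (t C). \<not> F0 \<subseteq> G} = {G\<in>C. \<not> F0 \<subseteq> G}"
    unfolding toggle_def t_def by auto
  then show "t (toggle C (t C)) = t C"
    using t_eq[of "toggle C (t C)"] t_eq[of C] by simp
qed

text \<open>After swapping the sums, for fixed \<open>D\<close> the sets \<open>C\<close> run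
  through all subsets of \<open>D - V\<close>, since \<open>\<C>\<close> is closed under subsets.
  Their signs cancel unless \<open>D\<close> lies in \<open>V\<close>. The inner sum on the left is
  the coefficient \<open>l C\<close> of the next lemma.\<close>

lemma sum_sign_chains_avoiding:
  assumes \<C>: "finite \<C>" "\<And>C. C \<in> \<C> \<Longrightarrow> finite C" "\<And>C D. C \<in> \<C> \<Longrightarrow> D \<subseteq> C \<Longrightarrow> D \<in> \<C>"
  shows "(\<Sum>C\<in>{C\<in>\<C>. C \<inter> V = {}}. \<Sum>D\<in>{D\<in>\<C>. C \<subseteq> D}. (-1) ^ (card D + card C)) =
    (\<Sum>D\<in>{D\<in>\<C>. D \<subseteq> V}. (-1) ^ card D :: int)"
proof -
  have "(\<Sum>C\<in>{C\<in>\<C>. C \<inter> V = {}}. \<Sum>D\<in>{D\<in>\<C>. C \<subseteq> D}. (-1) ^ (card D + card C)) =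
    (\<Sum>D\<in>\<C>. \<Sum>C\<in>{C\<in>{C\<in>\<C>. C \<inter> V = {}}. C \<subseteq> D}. (-1) ^ (card D + card C) :: int)"
    using \<C>(1) by (intro sum.swap_restrict) auto
  also have "\<dots> = (\<Sum>D\<in>\<C>. (-1) ^ card D * (\<Sum>C\<in>Pow (D - V). (-1) ^ card C))"
  proof (rule sum.cong[OF refl])
    fix D assume "D \<in> \<C>"
    then have "{C\<in>{C\<in>\<C>. C \<inter> V = {}}. C \<subseteq> D} = Pow (D - V)"
      using \<C>(3) by blast
    then show "(\<Sum>C\<in>{C\<in>{C\<in>\<C>. C \<inter> V = {}}. C \<subseteq> D}. (-1) ^ (card D + card C)) =
      (-1) ^ card D * (\<Sum>C\<in>Pow (D - V). (-1) ^ card C :: int)"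
      by (simp add: power_add sum_distrib_left)
  qed
  also have "\<dots> = (\<Sum>D\<in>\<C>. if D \<subseteq> V then (-1) ^ card D else 0)"
    using \<C>(2) by (intro sum.cong) (auto simp: sum_sign_Pow)
  also have "\<dots> = (\<Sum>D\<in>{D\<in>\<C>. D \<subseteq> V}. (-1) ^ card D)"
    using \<C>(1) by (simp add: sum.inter_filter)
  finally show ?thesis .
qed

text \<open>Fix a point \<open>x\<close> of the hypersimplex and let \<open>V\<close> be the family
  of sets whose rank inequality fails at \<open>x\<close>. The chains whose polytope contains
  \<open>x\<close> are those avoiding \<open>V\<close>, and their coefficients add up to the signed
  number of chains inside \<open>V\<close>. This is 1 if \<open>V\<close> is empty and 0
  otherwise.\<close>

lemma schubert_expansion_exists:
  assumes M: "M \<in> matroids r n"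
  shows "\<exists>a :: matroid \<Rightarrow> int. (\<forall>S. S \<notin> schubert_matroids r n \<longrightarrow> a S = 0) \<and>
    (\<forall>x. indicator (base_polytope M) x =
      (\<Sum>S\<in>schubert_matroids r n. a S * indicator (base_polytope S) x)) \<and>
    (\<Sum>S\<in>schubert_matroids r n. a S) = 1"
proof -
  define \<C> where "\<C> = {C. C \<subseteq> Pow {1..n} \<and> chain\<^sub>\<subseteq> C}"
  define N where "N = (\<lambda>C. capped_sets r n (insert {1..n} C) (rank_of M))"
  define l where "l = (\<lambda>C. \<Sum>D\<in>{D\<in>\<C>. C \<subseteq> D}. (-1) ^ (card D + card C) :: int)"
  \<comment> \<open>Several chains may cut out the same Schubert matroid; their coefficients are
    collected.\<close>
  define a where "a = (\<lambda>S. \<Sum>C\<in>{C\<in>\<C>. N C = S}. l C)"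
  have fin: "finite \<C>" "\<And>C. C \<in> \<C> \<Longrightarrow> finite C" and down: "\<And>C D. C \<in> \<C> \<Longrightarrow> D \<subseteq> C \<Longrightarrow> D \<in> \<C>"
    unfolding \<C>_def by (auto intro: finite_subset chain_subset_mono)
  have hyp: "insert {1..n} C \<subseteq> Pow {1..n}" "chain\<^sub>\<subseteq> (insert {1..n} C)" "{1..n} \<in> insert {1..n} C"
    "rank_of M {1..n} = r" "N C \<noteq> {}" if "C \<in> \<C>" for C
  proof -
    have "M \<subseteq> N C"
      using matroidsD(2,3)[OF M] card_inter_le_rank_of[OF M] unfolding N_def capped_sets_def by blast
    then show "N C \<noteq> {}"
      using matroidsD(1)[OF M] by blast
    show "insert {1..n} C \<subseteq> Pow {1..n}" "chain\<^sub>\<subseteq> (insert {1..n} C)"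
      using that chain_subset_insert[of C "{1..n}"] unfolding \<C>_def by blast+
  qed (use rank_of_ground[OF M] in auto)
  have NS: "N C \<in> schubert_matroids r n" if "C \<in> \<C>" for C
    unfolding N_def using hyp[OF that] by (intro capped_sets_schubert) (auto simp: N_def)
  have PN: "base_polytope (N C) = capped_polytope r n (insert {1..n} C) (rank_of M)" if "C \<in> \<C>" for C
    unfolding N_def using hyp[OF that] by (intro base_polytope_capped_sets) (auto simp: N_def)
  have regroup: "(\<Sum>S\<in>schubert_matroids r n. a S * h S) = (\<Sum>C\<in>\<C>. l C * h (N C))" for h
  proof -
    have "(\<Sum>S\<in>schubert_matroids r n. a S * h S) =
      (\<Sum>S\<in>schubert_matroids r n. \<Sum>C\<in>{C\<in>\<C>. N C = S}. l C * h (N C))"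
      unfolding a_def by (intro sum.cong refl) (simp add: sum_distrib_right)
    also have "\<dots> = (\<Sum>C\<in>\<C>. l C * h (N C))"
      using fin(1) finite_schubert_matroids NS by (intro sum.group) auto
    finally show ?thesis .
  qed
  have l_sum: "(\<Sum>C\<in>{C\<in>\<C>. C \<inter> V = {}}. l C) = (\<Sum>D\<in>{D\<in>\<C>. D \<subseteq> V}. (-1) ^ card D)" for V
    unfolding l_def using fin down by (rule sum_sign_chains_avoiding)
  have "(\<Sum>S\<in>schubert_matroids r n. a S) = 1"
  proof -
    \<comment> \<open>The total is the case of empty \<open>V\<close> in \<open>l_sum\<close>, where
      only the empty chain counts.\<close>
    have "{D\<in>\<C>. D \<subseteq> {}} = {{}}"
      unfolding \<C>_def chain_subset_def by auto
    then show ?thesis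
      using regroup[of "\<lambda>_. 1"] l_sum[of "{}"] by simp
  qed
  moreover have "indicator (base_polytope M) x =
      (\<Sum>S\<in>schubert_matroids r n. a S * indicator (base_polytope S) x)" for x
  proof (cases "x \<in> capped_polytope r n {} (rank_of M)")
    \<comment> \<open>Outside the hypersimplex all indicators vanish.\<close>
    case False
    then have "x \<notin> capped_polytope r n \<G> (rank_of M)" for \<G>
      unfolding capped_polytope_def by auto
    then have "(\<Sum>C\<in>\<C>. l C * indicator (base_polytope (N C)) x) = 0" "x \<notin> base_polytope M"
      using PN base_polytope_eq_capped_polytope[OF M] by (auto intro!: sum.neutral)
    then show ?thesis
      by (simp add: regroup)
  next
    case True
    \<comment> \<open>The ground set, which \<open>N\<close> adds to every chain, is tight at
      \<open>x\<close> and so never belongs to \<open>V\<close>.\<close>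
    define V where "V = {F\<in>Pow {1..n}. real (rank_of M F) < coord_sum x F}"
    have mem: "x \<in> capped_polytope r n \<G> (rank_of M) \<longleftrightarrow> (\<forall>F\<in>\<G>. coord_sum x F \<le> real (rank_of M F))" for \<G>
      using True unfolding capped_polytope_def by auto
    have xr: "coord_sum x {1..n} = real (rank_of M {1..n})"
      using True rank_of_ground[OF M] unfolding capped_polytope_def by simp
    have memN: "x \<in> base_polytope (N C) \<longleftrightarrow> C \<inter> V = {}" if "C \<in> \<C>" for C
      using that xr unfolding PN[OF that] mem V_def \<C>_def by (auto simp: not_less subset_iff disjoint_iff)
    have memM: "x \<in> base_polytope M \<longleftrightarrow> V = {}"
      unfolding base_polytope_eq_capped_polytope[OF M] mem V_def by (auto simp: not_less)
    have eq: "{D\<in>\<C>. D \<subseteq> V} = {C. C \<subseteq> V \<and> chain\<^sub>\<subseteq> C}"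
      unfolding \<C>_def V_def by auto
    have "(\<Sum>D\<in>{D\<in>\<C>. D \<subseteq> V}. (-1) ^ card D) = (of_bool (V = {}) :: int)"
    proof (cases "V = {}")
      case True
      have "{C. C \<subseteq> V \<and> chain\<^sub>\<subseteq> C} = {{}}"
        using True unfolding chain_subset_def by auto
      then show ?thesis
        unfolding eq using True by simp
    next
      case False
      \<comment> \<open>The excess \<open>f\<close> is supermodular. If \<open>F0\<close> has the
        greatest excess, then the excess of \<open>F0 \<union> G\<close> is at least that of
        \<open>G\<close>, so \<open>V\<close> is closed under joining with
        \<open>F0\<close>.\<close>
      define f where "f = (\<lambda>F. coord_sum x F - real (rank_of M F))"
      have finV: "finite V"
        unfolding V_def by simp
      have "Max (f ` V) \<in> f ` V"
        using finV False by (intro Max_in) auto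
      then obtain F0 where F0: "F0 \<in> V" "f F0 = Max (f ` V)"
        by auto
      have max: "f F \<le> f F0" if "F \<in> Pow {1..n}" for F
      proof (cases "F \<in> V")
        case True
        then show ?thesis
          using finV F0 by simp
      next
        case False
        then show ?thesis
          using that F0 unfolding V_def f_def by auto
      qed
      have "F0 \<union> G \<in> V" if G: "G \<in> V" for G
      proof -
        have sub: "F0 \<subseteq> {1..n}" "G \<subseteq> {1..n}"
          using F0 G unfolding V_def by auto
        then have "finite F0" "finite G"
          using finite_subset by blast+
        then have "coord_sum x (F0 \<union> G) + coord_sum x (F0 \<inter> G) = coord_sum x F0 + coord_sum x G"
          unfolding coord_sum_def by (rule sum.union_inter)
        moreover have "real (rank_of M (F0 \<union> G)) + real (rank_of M (F0 \<inter> G)) \<le>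
            real (rank_of M F0) + real (rank_of M G)"
          using rank_of_submodular[OF M, of F0 G] by linarith
        moreover have "f (F0 \<inter> G) \<le> f F0"
          using sub by (intro max) auto
        ultimately have "f G \<le> f (F0 \<union> G)"
          unfolding f_def by linarith
        then show ?thesis
          using G sub unfolding V_def f_def by auto
      qed
      then show ?thesis
        unfolding eq using sum_sign_chains_eq_0[OF finV F0(1)] False by simp
    qed
    moreover have "(\<Sum>C\<in>\<C>. l C * indicator (base_polytope (N C)) x) =
        (\<Sum>C\<in>\<C>. if C \<inter> V = {} then l C else 0)"
      by (intro sum.cong refl) (simp add: memN indicator_def)
    then have "(\<Sum>C\<in>\<C>. l C * indicator (base_polytope (N C)) x) = (\<Sum>C\<in>{C\<in>\<C>. C \<inter> V = {}}. l C)"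
      by (simp add: sum.inter_filter fin(1))
    ultimately show ?thesis
      using memM by (simp add: regroup l_sum indicator_def)
  qed
  moreover have "a S = 0" if "S \<notin> schubert_matroids r n" for S
  proof -
    have "{C\<in>\<C>. N C = S} = {}"
      using NS that by blast
    then show ?thesis
      unfolding a_def by (simp only: sum.empty)
  qed
  ultimately show ?thesis
    by blast
qed

subsection \<open>Linear independence\<close>

lemma bounded_linear_lookup: "bounded_linear (\<lambda>x :: 'i \<Rightarrow>\<^sub>0 real. Poly_Mapping.lookup x k)"
proof (rule bounded_linear_intro)
  fix x y :: "'i \<Rightarrow>\<^sub>0 real" and c :: real
  show "Poly_Mapping.lookup (x + y) k = Poly_Mapping.lookup x k + Poly_Mapping.lookup y k"
    by (simp add: lookup_add)
  show "Poly_Mapping.lookup (c *\<^sub>R x) k = c *\<^sub>R Poly_Mapping.lookup x k"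
    by (simp add: lookup_scaleR)
  have "norm x = (\<Sum>i\<in>Poly_Mapping.keys x. \<bar>Poly_Mapping.lookup x i\<bar>)"
    by (simp add: norm_poly_mapping_def dist_poly_mapping_def)
  then show "norm (Poly_Mapping.lookup x k) \<le> norm x * 1"
    using member_le_sum[of k "Poly_Mapping.keys x" "\<lambda>i. \<bar>Poly_Mapping.lookup x i\<bar>"]
    by (cases "k \<in> Poly_Mapping.keys x") (auto simp: in_keys_iff sum_nonneg)
qed

lemma continuous_on_lookup [continuous_intros]:
  "continuous_on A (\<lambda>x :: 'i \<Rightarrow>\<^sub>0 real. Poly_Mapping.lookup x k)"
  using bounded_linear.continuous_on[OF bounded_linear_lookup continuous_on_id] .

lemma continuous_on_coord_sum [continuous_intros]: "continuous_on A (\<lambda>x. coord_sum x F)"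
  unfolding coord_sum_def by (intro continuous_intros)

text \<open>The coefficients at the intervals with right endpoint \<open>t\<close> are detected by the jump of the sum just after \<open>t\<close>.\<close>

lemma sum_indicator_intervals_eq_0:
  fixes c :: "'i \<Rightarrow> int" and J :: "'i \<Rightarrow> real set"
  assumes fin: "finite I" and J: "\<And>i. i \<in> I \<Longrightarrow> compact (J i)" "\<And>i. i \<in> I \<Longrightarrow> convex (J i)"
    and zero: "\<And>t. (\<Sum>i\<in>I. c i * indicator (J i) t) = 0"
  shows "(\<Sum>i\<in>{i\<in>I. J i \<noteq> {}}. c i) = 0"
proof -
  have "\<exists>a b. J i = {a..b}" if "i \<in> I" for i
    using J[OF that] connected_compact_interval_1 convex_connected by blast
  then obtain a b where ab: "\<And>i. i \<in> I \<Longrightarrow> J i = {a i..b i}"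
    by metis
  define I' where "I' = {i\<in>I. J i \<noteq> {}}"
  have fin': "finite I'"
    unfolding I'_def using fin by simp
  have 0: "(\<Sum>i\<in>{i\<in>I'. b i = t}. c i) = 0" for t
  proof -
    \<comment> \<open>The endpoints beyond \<open>t\<close>. A point \<open>s\<close> strictly
      between \<open>t\<close> and all of them sees the same intervals as \<open>t\<close>, except
      those ending at \<open>t\<close>.\<close>
    define U where "U = {u \<in> a ` I \<union> b ` I. t < u}"
    have finU: "finite U"
      unfolding U_def using fin by simp
    obtain s where s: "t < s" "\<And>u. u \<in> U \<Longrightarrow> s < u"
    proof (cases "U = {}")
      case True
      then show ?thesis
        using that[of "t + 1"] by simp
    next
      case False
      then have "Min U \<in> U"
        using finU by simp
      then have "t < Min U"
        unfolding U_def by simp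
      then obtain s where "t < s" "s < Min U"
        using dense by blast
      then show ?thesis
        using that[of s] finU False by simp
    qed
    have a: "a i \<le> s \<Longrightarrow> a i \<le> t" and b: "t < b i \<Longrightarrow> s < b i" if "i \<in> I" for i
      using s(2)[of "a i"] s(2)[of "b i"] that unfolding U_def by force+
    have "indicator (J i) t - indicator (J i) s = (if i \<in> I' \<and> b i = t then 1 else 0 :: int)"
      if "i \<in> I" for i
      using a[OF that] b[OF that] s(1) that ab[OF that] unfolding I'_def
      by (auto simp: indicator_def)
    then have "(\<Sum>i\<in>I. c i * (indicator (J i) t - indicator (J i) s)) =
        (\<Sum>i\<in>I. c i * (if i \<in> I' \<and> b i = t then 1 else 0))"
      by (intro sum.cong refl) simp
    also have "\<dots> = (\<Sum>i\<in>I. if i \<in> I' \<and> b i = t then c i else 0)"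
      by (intro sum.cong refl) simp
    also have "\<dots> = (\<Sum>i\<in>{i\<in>I. i \<in> I' \<and> b i = t}. c i)"
      using fin by (simp add: sum.inter_filter)
    also have "{i\<in>I. i \<in> I' \<and> b i = t} = {i\<in>I'. b i = t}"
      unfolding I'_def by blast
    finally show ?thesis
      using zero[of t] zero[of s] by (simp add: right_diff_distrib sum_subtractf)
  qed
  have "(\<Sum>i\<in>I'. c i) = (\<Sum>t\<in>b ` I'. \<Sum>i\<in>{i\<in>I'. b i = t}. c i)"
    using fin' by (rule sum.image_gen)
  then show ?thesis
    using 0 unfolding I'_def by simp
qed

text \<open>
  The Euler characteristic is a linear function of the indicator function. The proof projects away one
  coordinate after the other; projections are rendered as cylinders, so that the ambient space is
  the same throughout.
\<close>

lemma sum_indicator_compact_convex_eq_0: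
  fixes c :: "'i \<Rightarrow> int" and P :: "'i \<Rightarrow> ('k \<Rightarrow>\<^sub>0 real) set"
  assumes fin: "finite I" "finite K"
    and P: "\<And>i. i \<in> I \<Longrightarrow> compact (P i)" "\<And>i. i \<in> I \<Longrightarrow> convex (P i)"
    and keys: "\<And>i y. i \<in> I \<Longrightarrow> y \<in> P i \<Longrightarrow> Poly_Mapping.keys y \<subseteq> K"
    and zero: "\<And>x. (\<Sum>i\<in>I. c i * indicator (P i) x) = 0"
  shows "(\<Sum>i\<in>{i\<in>I. P i \<noteq> {}}. c i) = 0"
proof -
  \<comment> \<open>\<open>E A i\<close> frees the coordinates in \<open>A\<close>: it is
    \<open>P i\<close> itself for empty \<open>A\<close>, and \<open>E K i\<close> contains 0
    exactly if \<open>P i\<close> is nonempty. The relation is carried along as \<open>A\<close>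
    grows.\<close>
  define E where "E = (\<lambda>A i. {x. \<exists>y\<in>P i. \<forall>k. k \<notin> A \<longrightarrow> Poly_Mapping.lookup y k = Poly_Mapping.lookup x k})"
  have "(\<Sum>i\<in>I. c i * indicator (E A i) x) = 0" if "finite A" for A x
    using that
  proof (induction A arbitrary: x)
    case empty
    have "(\<forall>k. Poly_Mapping.lookup y k = Poly_Mapping.lookup x k) \<longleftrightarrow> y = x" for x y :: "'k \<Rightarrow>\<^sub>0 real"
      by (auto intro: poly_mapping_eqI)
    then have "E {} i = P i" for i
      unfolding E_def by simp
    then show ?case
      using zero by simp
  next
    case (insert b A)
    \<comment> \<open>The range of coordinate \<open>b\<close> on the slice of \<open>P i\<close>
      that agrees with \<open>x\<close> outside \<open>insert b A\<close>. This is a compact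
      interval, nonempty exactly if \<open>x\<close> lies in
      \<open>E (insert b A) i\<close>.\<close>
    define J where "J = (\<lambda>i. (\<lambda>y. Poly_Mapping.lookup y b) `
      (P i \<inter> {y. \<forall>k\<in>- insert b A. Poly_Mapping.lookup y k = Poly_Mapping.lookup x k}))"
    have closed: "closed {y :: 'k \<Rightarrow>\<^sub>0 real. \<forall>k\<in>- insert b A. Poly_Mapping.lookup y k = Poly_Mapping.lookup x k}"
      unfolding Collect_ball_eq by (intro closed_INT ballI closed_Collect_eq continuous_intros)
    have convex: "convex {y :: 'k \<Rightarrow>\<^sub>0 real. \<forall>k\<in>- insert b A. Poly_Mapping.lookup y k = Poly_Mapping.lookup x k}"
    proof (rule convexI)
      fix y z :: "'k \<Rightarrow>\<^sub>0 real" and u v :: real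
      assume "u + v = 1"
      then have "u * a + v * a = a" for a
        by (metis distrib_right mult_1)
      moreover assume "y \<in> {y. \<forall>k\<in>- insert b A. Poly_Mapping.lookup y k = Poly_Mapping.lookup x k}"
        "z \<in> {y. \<forall>k\<in>- insert b A. Poly_Mapping.lookup y k = Poly_Mapping.lookup x k}"
      ultimately show "u *\<^sub>R y + v *\<^sub>R z \<in> {y. \<forall>k\<in>- insert b A. Poly_Mapping.lookup y k = Poly_Mapping.lookup x k}"
        by (simp add: lookup_add lookup_scaleR)
    qed
    have "compact (J i)" if "i \<in> I" for i
      unfolding J_def using P(1)[OF that] closed
      by (intro compact_continuous_image compact_Int_closed continuous_intros)
    moreover have "convex (J i)" if "i \<in> I" for i
      unfolding J_def using P(2)[OF that] convex
      by (intro convex_linear_image convex_Int bounded_linear.linear[OF bounded_linear_lookup])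
    moreover have "(\<Sum>i\<in>I. c i * indicator (J i) t) = 0" for t
    proof -
      \<comment> \<open>\<open>x\<close> with coordinate \<open>b\<close> replaced by
        \<open>t\<close>. As \<open>b\<close> is not in \<open>A\<close>, membership of
        \<open>t\<close> in \<open>J i\<close> is membership of \<open>z\<close> in
        \<open>E A i\<close>, where the induction hypothesis applies.\<close>
      define z where "z = x + Poly_Mapping.single b (t - Poly_Mapping.lookup x b)"
      have z: "Poly_Mapping.lookup z k = (if k = b then t else Poly_Mapping.lookup x k)" for k
        by (simp add: z_def lookup_add lookup_single when_def)
      have "t \<in> J i \<longleftrightarrow> z \<in> E A i" for i
        unfolding J_def E_def using insert.hyps(2) by (auto simp: z image_iff)
      then have "indicator (J i) t = (indicator (E A i) z :: int)" for i
        by (simp add: indicator_def)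
      then show ?thesis
        using insert.IH[of z] by simp
    qed
    ultimately have "(\<Sum>i\<in>{i\<in>I. J i \<noteq> {}}. c i) = 0"
      by (rule sum_indicator_intervals_eq_0[OF fin(1)])
    moreover have "x \<in> E (insert b A) i \<longleftrightarrow> J i \<noteq> {}" for i
      unfolding E_def J_def by auto
    then have "(\<Sum>i\<in>I. c i * indicator (E (insert b A) i) x) = (\<Sum>i\<in>I. if J i \<noteq> {} then c i else 0)"
      by (intro sum.cong refl) (simp add: indicator_def)
    ultimately show ?case
      using fin(1) by (simp add: sum.inter_filter)
  qed
  moreover have "0 \<in> E K i \<longleftrightarrow> P i \<noteq> {}" if "i \<in> I" for i
  proof -
    have "Poly_Mapping.lookup y k = 0" if "y \<in> P i" "k \<notin> K" for y k
      using keys[OF \<open>i \<in> I\<close> that(1)] that(2) by (auto simp: in_keys_iff)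
    then show ?thesis
      unfolding E_def by auto
  qed
  then have "(\<Sum>i\<in>I. c i * indicator (E K i) 0) = (\<Sum>i\<in>I. if P i \<noteq> {} then c i else 0)"
    by (intro sum.cong refl) (simp add: indicator_def)
  ultimately show ?thesis
    using fin by (simp add: sum.inter_filter)
qed

lemma base_polytope_compact_convex:
  assumes "M \<in> matroids r n"
  shows "compact (base_polytope M)" "convex (base_polytope M)"
    "\<And>x. x \<in> base_polytope M \<Longrightarrow> Poly_Mapping.keys x \<subseteq> {1..n}"
proof -
  show "compact (base_polytope M)"
    unfolding base_polytope_def using matroidsD(5)[OF assms]
    by (intro finite_imp_compact_convex_hull finite_imageI)
  show "convex (base_polytope M)"
    unfolding base_polytope_def by (rule convex_convex_hull)
  show "Poly_Mapping.keys x \<subseteq> {1..n}" if "x \<in> base_polytope M" for x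
    using that unfolding base_polytope_eq_capped_polytope[OF assms] capped_polytope_def by blast
qed

text \<open>Cutting all polytopes with a common closed convex set preserves the relation, and the
  Euler characteristic then sums \<open>c\<close> over those with nonempty cut. For lower bounds
  along a chain, a nonempty cut is a condition on ranks, because one basis attains all ranks of the
  chain.\<close>

lemma sum_rank_of_eq_0:
  fixes c :: "matroid \<Rightarrow> int"
  assumes \<S>: "\<S> \<subseteq> matroids r n" and C: "C \<subseteq> Pow {1..n}" "chain\<^sub>\<subseteq> C"
    and zero: "\<And>x. Poly_Mapping.keys x \<subseteq> {1..n} \<Longrightarrow> (\<Sum>S\<in>\<S>. c S * indicator (base_polytope S) x) = 0"
  shows "(\<Sum>S\<in>{S\<in>\<S>. \<forall>F\<in>C. rank_of S F = \<rho> F}. c S) = 0"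
proof -
  have fin: "finite \<S>" "finite C"
    using \<S> C(1) finite_matroids by (auto intro: finite_subset)
  define up where "up = (\<lambda>k S. (\<forall>F\<in>C. \<rho> F \<le> rank_of S F) \<and> k \<le> (\<Sum>F\<in>C. rank_of S F))"
  have up: "(\<Sum>S\<in>{S\<in>\<S>. up k S}. c S) = 0" for k
  proof -
    \<comment> \<open>The geometric form of \<open>up\<close>: one half-space for each member of the
      chain and one for the total.\<close>
    define H where "H = (\<Inter>F\<in>C. {x. real (\<rho> F) \<le> coord_sum x F}) \<inter> {x. real k \<le> (\<Sum>F\<in>C. coord_sum x F)}"
    have lin: "linear (\<lambda>x. coord_sum x F)" for F :: "nat set"
      by (rule linearI) (simp_all add: coord_sum_simps)
    have half: "convex {x. d \<le> f x}" if "linear f" for f :: "(nat \<Rightarrow>\<^sub>0 real) \<Rightarrow> real" and d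
      using convex_linear_vimage[OF that convex_real_interval(1)[of d]] by (simp add: vimage_def)
    have "closed H"
      unfolding H_def by (intro closed_Int closed_INT ballI closed_Collect_le continuous_intros)
    moreover have "convex H"
      unfolding H_def by (intro convex_Int convex_INT half linear_compose_sum ballI lin)
    ultimately have P: "compact (base_polytope S \<inter> H)" "convex (base_polytope S \<inter> H)"
      "\<And>y. y \<in> base_polytope S \<inter> H \<Longrightarrow> Poly_Mapping.keys y \<subseteq> {1..n}" if "S \<in> \<S>" for S
      using base_polytope_compact_convex[of S r n] that \<S>
      by (blast intro: compact_Int_closed convex_Int)+
    have "(\<Sum>S\<in>{S\<in>\<S>. base_polytope S \<inter> H \<noteq> {}}. c S) = 0"
    proof (intro sum_indicator_compact_convex_eq_0[of _ "{1..n}"] fin)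
      fix x
      show "(\<Sum>S\<in>\<S>. c S * indicator (base_polytope S \<inter> H) x) = 0"
      proof (cases "Poly_Mapping.keys x \<subseteq> {1..n}")
        case True
        have "(\<Sum>S\<in>\<S>. c S * indicator (base_polytope S \<inter> H) x) =
            (\<Sum>S\<in>\<S>. c S * indicator (base_polytope S) x) * indicator H x"
          by (simp add: sum_distrib_right indicator_inter_arith mult.assoc)
        then show ?thesis
          using zero[OF True] by simp
      next
        case False
        then have "x \<notin> base_polytope S" if "S \<in> \<S>" for S
          using base_polytope_compact_convex(3) that \<S> by blast
        then show ?thesis
          by (intro sum.neutral) simp
      qed
    qed (use P in blast)+
    moreover have "base_polytope S \<inter> H \<noteq> {} \<longleftrightarrow> up k S" if "S \<in> \<S>" for S
    proof
      have S: "S \<in> matroids r n"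
        using that \<S> by blast
      {
        assume "base_polytope S \<inter> H \<noteq> {}"
        then obtain x where x: "x \<in> base_polytope S" "x \<in> H"
          by blast
        have le: "coord_sum x F \<le> real (rank_of S F)" if "F \<in> C" for F
          using x(1) that C(1) unfolding base_polytope_eq_capped_polytope[OF S] capped_polytope_def by blast
        have "real (\<rho> F) \<le> real (rank_of S F)" if "F \<in> C" for F
          using le[OF that] that x(2) unfolding H_def by fastforce
        moreover have "(\<Sum>F\<in>C. coord_sum x F) \<le> (\<Sum>F\<in>C. real (rank_of S F))"
          by (rule sum_mono[OF le])
        then have "real k \<le> real (\<Sum>F\<in>C. rank_of S F)"
          using x(2) unfolding H_def by simp
        ultimately show "up k S"
          unfolding up_def of_nat_le_iff by blast
      }
      assume u: "up k S"
      obtain B where B: "B \<in> S" "\<And>F. F \<in> C \<Longrightarrow> card (B \<inter> F) = rank_of S F"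
        using chain_rank_of_attained[OF S fin(2) C(2)] by blast
      have cs: "coord_sum (indicator_vec B) F = real (rank_of S F)" if "F \<in> C" for F
      proof -
        have "finite F"
          using C(1) that finite_subset by blast
        then show ?thesis
          using B(2)[OF that] matroidsD(4)[OF S B(1)] by (simp add: coord_sum_indicator_vec)
      qed
      have "(\<Sum>F\<in>C. coord_sum (indicator_vec B) F) = real (\<Sum>F\<in>C. rank_of S F)"
        using cs by simp
      then have "indicator_vec B \<in> H"
        using u cs unfolding H_def up_def by (simp flip: of_nat_sum)
      moreover have "indicator_vec B \<in> base_polytope S"
        unfolding base_polytope_def using B(1) by (intro hull_inc) blast
      ultimately show "base_polytope S \<inter> H \<noteq> {}"
        by blast
    qed
    then have "{S\<in>\<S>. base_polytope S \<inter> H \<noteq> {}} = {S\<in>\<S>. up k S}"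
      by blast
    ultimately show ?thesis
      by simp
  qed
  \<comment> \<open>Given the lower bounds \<open>\<rho>\<close>, the ranks equal
    \<open>\<rho>\<close> exactly if their total does not exceed that of \<open>\<rho>\<close>. So
    the desired sum is the one for \<open>up 0\<close> minus the one for
    \<open>up ?k\<close>.\<close>
  let ?k = "Suc (\<Sum>F\<in>C. \<rho> F)"
  have "up 0 S \<longleftrightarrow> (\<forall>F\<in>C. rank_of S F = \<rho> F) \<or> up ?k S" for S
  proof -
    have "rank_of S F = \<rho> F" if "\<forall>F\<in>C. \<rho> F \<le> rank_of S F" "(\<Sum>F\<in>C. rank_of S F) \<le> (\<Sum>F\<in>C. \<rho> F)" "F \<in> C" for F
    proof (rule ccontr)
      assume "rank_of S F \<noteq> \<rho> F"
      then have "\<rho> F < rank_of S F"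
        using that by (simp add: le_neq_implies_less)
      then have "(\<Sum>F\<in>C. \<rho> F) < (\<Sum>F\<in>C. rank_of S F)"
        using that(1,3) by (intro sum_strict_mono_ex1 fin) auto
      then show False
        using that(2) by simp
    qed
    note eq = this
    show ?thesis
    proof (cases "(\<Sum>F\<in>C. rank_of S F) \<le> (\<Sum>F\<in>C. \<rho> F)")
      case True
      then show ?thesis
        unfolding up_def using eq by auto
    next
      case False
      then show ?thesis
        unfolding up_def by (auto simp: not_less_eq_eq)
    qed
  qed
  then have "{S\<in>\<S>. up 0 S} = {S\<in>\<S>. \<forall>F\<in>C. rank_of S F = \<rho> F} \<union> {S\<in>\<S>. up ?k S}"
    by blast
  moreover have "\<not> up ?k S" if "\<forall>F\<in>C. rank_of S F = \<rho> F" for S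
    using that unfolding up_def by simp
  then have "{S\<in>\<S>. \<forall>F\<in>C. rank_of S F = \<rho> F} \<inter> {S\<in>\<S>. up ?k S} = {}"
    by blast
  ultimately have "(\<Sum>S\<in>{S\<in>\<S>. up 0 S}. c S) =
      (\<Sum>S\<in>{S\<in>\<S>. \<forall>F\<in>C. rank_of S F = \<rho> F}. c S) + (\<Sum>S\<in>{S\<in>\<S>. up ?k S}. c S)"
    using fin by (simp add: sum.union_disjoint)
  then show ?thesis
    using up by simp
qed

section \<open>Circuits and cyclic flats\<close>

lemma circuit_exists:
  assumes "X \<subseteq> {1..n}" "\<not> indep M X"
  shows "\<exists>D\<in>circuits n M. D \<subseteq> X"
proof -
  let ?\<D> = "{D. D \<subseteq> X \<and> \<not> indep M D}"
  have "finite X"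
    using assms(1) finite_subset by blast
  then have "finite ?\<D>" "?\<D> \<noteq> {}"
    using assms(2) by auto
  then obtain D where D: "D \<in> ?\<D>" "\<forall>D'\<in>?\<D>. D' \<subseteq> D \<longrightarrow> D = D'"
    using finite_has_minimal[of ?\<D>] by blast
  then have "\<forall>D'. D' \<subset> D \<longrightarrow> indep M D'"
    by blast
  moreover have "D \<subseteq> {1..n}"
    using D(1) assms(1) by blast
  ultimately have "D \<in> circuits n M"
    using D(1) unfolding circuits_def by simp
  then show ?thesis
    using D(1) by blast
qed

text \<open>The witness is the closure of \<open>D\<close>, the set of elements that do not raise
  its rank. It has the rank of \<open>D\<close>, which is one less than the size of
  \<open>D\<close>, and every element of it lies on a circuit inside it.\<close>

lemma circuit_closure:
  assumes M: "M \<in> matroids r n" and D: "D \<in> circuits n M"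
  shows "\<exists>F\<in>cyclic_flats n M. D \<subseteq> F \<and> rank_of M F < card D"
proof -
  have Dsub: "D \<subseteq> {1..n}" and Ddep: "\<not> indep M D" and Dind: "\<And>D'. D' \<subset> D \<Longrightarrow> indep M D'"
    using D unfolding circuits_def by auto
  have finD: "finite D"
    using Dsub finite_subset by blast
  have "D \<noteq> {}"
    using Ddep matroidsD(1)[OF M] unfolding indep_def by auto
  then obtain d where d: "d \<in> D"
    by blast
  define I where "I = D - {d}"
  have I: "indep M I" "I \<subseteq> D" "card D = Suc (card I)"
    using Dind[of I] d finD card_Suc_Diff1[OF finD d] unfolding I_def by auto
  have rkD: "rank_of M D = card I"
  proof -
    obtain A where A: "A \<in> M" "card (A \<inter> D) = rank_of M D"
      using rank_of_attained[OF M] by blast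
    have "rank_of M D < card D"
    proof (rule ccontr)
      assume "\<not> rank_of M D < card D"
      then have "A \<inter> D = D"
        using A(2) finD by (intro card_seteq) auto
      then show False
        using A(1) Ddep unfolding indep_def by blast
    qed
    then show ?thesis
      using indep_card_le_rank_of[OF M I(1,2)] I(3) by linarith
  qed
  define F where "F = {e\<in>{1..n}. rank_of M (insert e D) = rank_of M D}"
  have DF: "D \<subseteq> F"
    using Dsub unfolding F_def by (auto simp: insert_absorb)
  have rkF: "rank_of M F = rank_of M D"
  proof -
    \<comment> \<open>An element of \<open>A \<inter> F\<close> outside \<open>I\<close> would form
      with \<open>I\<close> an independent set larger than the rank of \<open>D\<close>, against the
      definition of \<open>F\<close>. So \<open>A\<close> meets \<open>F\<close> only in
      \<open>I\<close>.\<close>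
    obtain A where A: "A \<in> M" "I \<subseteq> A" "card (A \<inter> F) = rank_of M F"
      using indep_extend[OF M I(1)] I(2) DF by (meson subset_trans)
    have "A \<inter> F \<subseteq> I"
    proof
      fix e assume e: "e \<in> A \<inter> F"
      show "e \<in> I"
      proof (rule ccontr)
        assume "e \<notin> I"
        have "indep M (insert e I)"
          using A(1,2) e unfolding indep_def by blast
        then have "card (insert e I) \<le> rank_of M (insert e D)"
          using I(2) by (intro indep_card_le_rank_of[OF M]) auto
        then show False
          using e \<open>e \<notin> I\<close> rkD finite_subset[OF I(2) finD] unfolding F_def by simp
      qed
    qed
    then have "rank_of M F \<le> card I"
      using A(3) finite_subset[OF I(2) finD] by (metis card_mono)
    then show ?thesis
      using rank_of_mono[OF M DF] rkD by simp
  qed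
  have "rank_of M F < rank_of M (insert e F)" if "e \<in> {1..n} - F" for e
  proof -
    have "rank_of M D \<noteq> rank_of M (insert e D)"
      using that unfolding F_def by auto
    then have "rank_of M D < rank_of M (insert e D)"
      using rank_of_mono[OF M, of D "insert e D"] by (auto simp: less_le)
    also have "\<dots> \<le> rank_of M (insert e F)"
      using DF by (intro rank_of_mono[OF M]) auto
    finally show ?thesis
      using rkF by simp
  qed
  then have flat: "F \<in> flats n M"
    unfolding flats_def F_def by auto
  have "F \<subseteq> \<Union>{D'\<in>circuits n M. D' \<subseteq> F}"
  proof
    fix e assume e: "e \<in> F"
    show "e \<in> \<Union>{D'\<in>circuits n M. D' \<subseteq> F}"
    proof (cases "e \<in> D")
      case True
      then show ?thesis
        using D DF by blast
    next
      case False
      \<comment> \<open>\<open>insert e I\<close> is too large to be independent, so it contains a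
        circuit. That circuit passes through \<open>e\<close> because \<open>I\<close> is
        independent.\<close>
      then have "card (insert e I) = Suc (card I)"
        using I(2) finite_subset[OF I(2) finD] by (subst card_insert_disjoint) auto
      moreover have "rank_of M (insert e D) = card I"
        using e rkD unfolding F_def by simp
      ultimately have "\<not> indep M (insert e I)"
        using indep_card_le_rank_of[OF M, of "insert e I" "insert e D"] I(2) by auto
      moreover have "insert e I \<subseteq> {1..n}"
        using e I(2) Dsub unfolding F_def by blast
      ultimately obtain D' where D': "D' \<in> circuits n M" "D' \<subseteq> insert e I"
        using circuit_exists by blast
      have "\<not> indep M D'"
        using D'(1) unfolding circuits_def by simp
      then have "\<not> D' \<subseteq> I"
        using indep_subset[OF I(1)] by blast
      then have "e \<in> D'" "D' \<subseteq> F"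
        using D'(2) e I(2) DF by blast+
      then show ?thesis
        using D'(1) by blast
    qed
  qed
  then have eq: "F = \<Union>{D'\<in>circuits n M. D' \<subseteq> F}"
    by blast
  have "\<exists>\<C>. \<C> \<subseteq> circuits n M \<and> F = \<Union>\<C>"
    by (rule exI[of _ "{D'\<in>circuits n M. D' \<subseteq> F}"], rule conjI[OF _ eq]) blast
  then have "F \<in> cyclic_flats n M"
    using flat unfolding cyclic_flats_def by simp
  then show ?thesis
    using DF rkF rkD I(3) by auto
qed

text \<open>An \<open>r\<close>-set that is not a basis contains a circuit, and the closure of this
  circuit is a cyclic flat whose inequality fails.\<close>

lemma basis_if_cyclic_flats:
  assumes M: "M \<in> matroids r n" and B: "B \<subseteq> {1..n}" "card B = r"
    and le: "\<And>F. F \<in> cyclic_flats n M \<Longrightarrow> card (B \<inter> F) \<le> rank_of M F"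
  shows "B \<in> M"
proof (rule ccontr)
  assume "B \<notin> M"
  have "\<not> indep M B"
  proof
    assume "indep M B"
    then obtain A where A: "A \<in> M" "B \<subseteq> A"
      unfolding indep_def by blast
    then have "B = A"
      using B(2) matroidsD(3,4)[OF M A(1)] by (intro card_seteq) auto
    then show False
      using A(1) \<open>B \<notin> M\<close> by simp
  qed
  then obtain D where D: "D \<in> circuits n M" "D \<subseteq> B"
    using circuit_exists B(1) by blast
  then obtain F where F: "F \<in> cyclic_flats n M" "D \<subseteq> F" "rank_of M F < card D"
    using circuit_closure[OF M] by blast
  have "finite B"
    using B(1) finite_subset by blast
  then have "card D \<le> card (B \<inter> F)"
    using D(2) F(2) by (intro card_mono) auto
  then show False
    using le[OF F(1)] F(3) by simp
qed

text \<open>Triangularity: let \<open>T\<close> be inclusion-minimal with nonzero coefficient and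
  test with the chain of its cyclic flats. A matroid with the same ranks on that chain is contained
  in \<open>T\<close> by \<open>basis_if_cyclic_flats\<close>, so by minimality only the coefficient
  of \<open>T\<close> survives.\<close>

lemma schubert_indicators_independent:
  fixes c :: "matroid \<Rightarrow> int"
  assumes zero: "\<And>x. Poly_Mapping.keys x \<subseteq> {1..n} \<Longrightarrow>
      (\<Sum>S\<in>schubert_matroids r n. c S * indicator (base_polytope S) x) = 0"
    and "S \<in> schubert_matroids r n"
  shows "c S = 0"
proof (rule ccontr)
  assume "c S \<noteq> 0"
  let ?\<S> = "schubert_matroids r n"
  note sub = schubert_subset_matroids[of r n] and fin = finite_schubert_matroids[of r n]
  have "finite {S\<in>?\<S>. c S \<noteq> 0}" "{S\<in>?\<S>. c S \<noteq> 0} \<noteq> {}"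
    using fin assms(2) \<open>c S \<noteq> 0\<close> by auto
  then obtain T where T: "T \<in> ?\<S>" "c T \<noteq> 0"
    and min: "\<And>S. S \<in> ?\<S> \<Longrightarrow> c S \<noteq> 0 \<Longrightarrow> S \<subseteq> T \<Longrightarrow> S = T"
    using finite_has_minimal[of "{S\<in>?\<S>. c S \<noteq> 0}"] by blast
  let ?C = "cyclic_flats n T" and ?\<R> = "{S\<in>?\<S>. \<forall>F\<in>cyclic_flats n T. rank_of S F = rank_of T F}"
  have "?C \<subseteq> Pow {1..n}"
    unfolding cyclic_flats_def flats_def by blast
  moreover have "chain\<^sub>\<subseteq> ?C"
    using T(1) unfolding schubert_matroids_def by blast
  ultimately have "(\<Sum>S\<in>?\<R>. c S) = 0"
    using zero by (rule sum_rank_of_eq_0[OF sub])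
  moreover have "c S = 0" if S: "S \<in> ?\<R> - {T}" for S
  proof -
    have SM: "S \<in> matroids r n" and TM: "T \<in> matroids r n"
      using S T(1) sub by blast+
    have "S \<subseteq> T"
    proof
      fix B assume B: "B \<in> S"
      have "card (B \<inter> F) \<le> rank_of T F" if "F \<in> ?C" for F
        using card_inter_le_rank_of[OF SM B, of F] S that by simp
      then show "B \<in> T"
        using matroidsD(2,3)[OF SM B] by (intro basis_if_cyclic_flats[OF TM])
    qed
    then show ?thesis
      using min[of S] S by blast
  qed
  moreover have "T \<in> ?\<R>" "finite ?\<R>"
    using T(1) fin by auto
  ultimately have "c T = 0"
    by (simp add: sum.remove[of ?\<R> T])
  then show False
    using T(2) by simp
qed

subsection \<open>Dimension\<close>

text \<open>Differences of unit vectors with a fixed one lie in the direction space, are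
  independent, and span the vectors on \<open>I\<close> with coordinate sum 0. The direction space
  consists of such vectors because \<open>X\<close> lies in the hyperplane of coordinate sum
  1.\<close>

lemma affine_dim_convex_hull:
  fixes X :: "('i \<Rightarrow>\<^sub>0 real) set"
  assumes I: "finite I" and X: "X \<noteq> {}"
    and keys: "\<And>x. x \<in> X \<Longrightarrow> Poly_Mapping.keys x \<subseteq> I" and sum1: "\<And>x. x \<in> X \<Longrightarrow> coord_sum x I = 1"
    and unit: "\<And>i. i \<in> I \<Longrightarrow> Poly_Mapping.single i 1 \<in> X"
  shows "affine_dim (convex hull X) = int (card I) - 1"
proof -
  have "I \<noteq> {}"
    using X sum1 by (auto simp: coord_sum_def)
  then obtain i0 where i0: "i0 \<in> I"
    by blast
  define b where "b = (\<lambda>i. Poly_Mapping.single i (1::real) - Poly_Mapping.single i0 1)"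
  let ?J = "I - {i0}" and ?V = "{x - y | x y. x \<in> affine hull X \<and> y \<in> affine hull X}"
  have lookup_comb: "Poly_Mapping.lookup (\<Sum>j\<in>?J. u j *\<^sub>R b j) i = u i" if "i \<in> ?J" for u i
  proof -
    have "Poly_Mapping.lookup (b j) i = (if j = i then 1 else 0)" for j
      using that by (auto simp: b_def lookup_minus lookup_single)
    then have "Poly_Mapping.lookup (\<Sum>j\<in>?J. u j *\<^sub>R b j) i = (\<Sum>j\<in>?J. if j = i then u j else 0)"
      unfolding lookup_sum lookup_scaleR by (intro sum.cong) auto
    then show ?thesis
      using that I by simp
  qed
  have inj: "inj_on b ?J"
  proof (rule inj_onI)
    fix i j assume "b i = b j"
    then have "Poly_Mapping.single i (1::real) = Poly_Mapping.single j 1"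
      unfolding b_def by simp
    then have "Poly_Mapping.lookup (Poly_Mapping.single i (1::real)) j = 1"
      by simp
    then show "i = j"
      by (simp add: lookup_single when_def split: if_splits)
  qed
  have "b ` ?J \<subseteq> ?V"
    using unit i0 hull_inc[of _ X affine] unfolding b_def by blast
  moreover have "?V \<subseteq> span (b ` ?J)"
  proof
    let ?A = "{x. Poly_Mapping.keys x \<subseteq> I \<and> coord_sum x I = 1}"
    have "affine ?A"
      unfolding affine_def
    proof (intro ballI allI impI)
      fix x y and u v :: real
      assume "x \<in> ?A" "y \<in> ?A" "u + v = 1"
      moreover have "Poly_Mapping.keys (u *\<^sub>R x + v *\<^sub>R y) \<subseteq> Poly_Mapping.keys x \<union> Poly_Mapping.keys y"
        by (auto simp: in_keys_iff lookup_add lookup_scaleR)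
      ultimately show "u *\<^sub>R x + v *\<^sub>R y \<in> ?A"
        by (auto simp: coord_sum_simps)
    qed
    then have hull: "affine hull X \<subseteq> ?A"
      using keys sum1 by (intro hull_minimal) auto
    fix z assume "z \<in> ?V"
    then obtain x y where z: "z = x - y" and xy: "x \<in> ?A" "y \<in> ?A"
      using hull by blast
    have zI: "Poly_Mapping.lookup z i = 0" if "i \<notin> I" for i
    proof -
      have "i \<notin> Poly_Mapping.keys x" "i \<notin> Poly_Mapping.keys y"
        using xy that by auto
      then show ?thesis
        unfolding z by (simp add: lookup_minus in_keys_iff)
    qed
    have "coord_sum z I = 0"
      using xy unfolding z by (simp add: coord_sum_simps)
    \<comment> \<open>The coordinate at \<open>i0\<close> is determined by the others, which serve
      as the coefficients in the basis \<open>b\<close>.\<close>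
    then have zi0: "Poly_Mapping.lookup z i0 = - (\<Sum>j\<in>?J. Poly_Mapping.lookup z j)"
      unfolding coord_sum_def using I i0 by (simp add: sum.remove)
    have "z = (\<Sum>j\<in>?J. Poly_Mapping.lookup z j *\<^sub>R b j)"
    proof (rule poly_mapping_eqI)
      fix k
      consider "k \<in> ?J" | "k = i0" | "k \<notin> I"
        by blast
      then show "Poly_Mapping.lookup z k = Poly_Mapping.lookup (\<Sum>j\<in>?J. Poly_Mapping.lookup z j *\<^sub>R b j) k"
      proof cases
        case 1
        then show ?thesis
          by (simp add: lookup_comb)
      next
        case 2
        have "Poly_Mapping.lookup (b j) i0 = -1" if "j \<in> ?J" for j
          using that by (simp add: b_def lookup_minus lookup_single)
        then have "(\<Sum>j\<in>?J. Poly_Mapping.lookup z j * Poly_Mapping.lookup (b j) i0) =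
            (\<Sum>j\<in>?J. - Poly_Mapping.lookup z j)"
          by (intro sum.cong refl) simp
        then show ?thesis
          unfolding 2 zi0 by (simp add: lookup_sum lookup_scaleR sum_negf)
      next
        case 3
        have "Poly_Mapping.lookup (b j) k = 0" if "j \<in> ?J" for j
          using that 3 i0 by (auto simp: b_def lookup_minus lookup_single when_def)
        then have "(\<Sum>j\<in>?J. Poly_Mapping.lookup z j * Poly_Mapping.lookup (b j) k) = 0"
          by (intro sum.neutral) simp
        then show ?thesis
          using zI[OF 3] by (simp add: lookup_sum lookup_scaleR)
      qed
    qed
    also have "\<dots> \<in> span (b ` ?J)"
      by (intro span_sum span_scale span_base) simp
    finally show "z \<in> span (b ` ?J)" .
  qed
  moreover have "independent (b ` ?J)"
  proof (rule independent_if_scalars_zero)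
    fix f v assume 0: "(\<Sum>v\<in>b ` ?J. f v *\<^sub>R v) = 0" and "v \<in> b ` ?J"
    then obtain i where i: "i \<in> ?J" "v = b i"
      by blast
    have "(\<Sum>j\<in>?J. f (b j) *\<^sub>R b j) = 0"
      using 0 by (simp add: sum.reindex[OF inj])
    then show "f v = 0"
      using lookup_comb[OF i(1), of "f \<circ> b"] i(2) by simp
  qed (use I in simp)
  ultimately have "dim ?V = card ?J"
    using card_image[OF inj] by (intro dim_unique[where B = "b ` ?J"]) auto
  moreover have "Suc (card ?J) = card I"
    using I i0 by (rule card_Suc_Diff1)
  ultimately show ?thesis
    using X by (simp add: affine_dim_def affine_hull_convex_hull flip: \<open>Suc (card ?J) = card I\<close>)
qed

lemma keys_sum_single: "Poly_Mapping.keys (\<Sum>i\<in>I. Poly_Mapping.single i (w i)) \<subseteq> I"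
  by (rule order.trans[OF keys_sum]) auto

lemma coord_sum_sum_single:
  "finite I \<Longrightarrow> coord_sum (\<Sum>i\<in>I. Poly_Mapping.single i (w i)) I = (\<Sum>i\<in>I. w i)"
  by (simp add: coord_sum_def lookup_sum lookup_single when_def sum.delta cong: sum.cong)

lemma sum_single_delta:
  assumes "finite I" "j \<in> I" "\<And>i. i \<in> I \<Longrightarrow> w i = of_bool (i = j)"
  shows "(\<Sum>i\<in>I. Poly_Mapping.single i (w i)) = Poly_Mapping.single j (1::real)"
proof -
  have "(\<Sum>i\<in>I. Poly_Mapping.single i (w i)) = (\<Sum>i\<in>I. if i = j then Poly_Mapping.single j 1 else 0)"
    using assms(3) by (intro sum.cong) auto
  then show ?thesis
    using assms(1,2) by simp
qed

text \<open>This resolves the \<open>THE\<close> in \<open>schubert_coeff\<close>: the difference of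
  two expansions is a relation among indicators of Schubert matroid polytopes, hence zero.\<close>

lemma schubert_coeff_eqI:
  assumes "\<And>S. S \<notin> schubert_matroids r n \<Longrightarrow> a S = 0"
    and "\<And>x. Poly_Mapping.keys x \<subseteq> {1..n} \<Longrightarrow> indicator (base_polytope M) x =
      (\<Sum>S\<in>schubert_matroids r n. a S * indicator (base_polytope S) x)"
  shows "schubert_coeff r n M = a"
  unfolding schubert_coeff_def
proof (rule the_equality)
  fix a' :: "matroid \<Rightarrow> int"
  assume a': "(\<forall>S. S \<notin> schubert_matroids r n \<longrightarrow> a' S = 0) \<and>
     (\<forall>x. Poly_Mapping.keys x \<subseteq> {1..n} \<longrightarrow> indicator (base_polytope M) x =
          (\<Sum>S\<in>schubert_matroids r n. a' S * indicator (base_polytope S) x))"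
  show "a' = a"
  proof
    fix S
    show "a' S = a S"
    proof (cases "S \<in> schubert_matroids r n")
      case True
      have "(\<Sum>S\<in>schubert_matroids r n. (a' S - a S) * indicator (base_polytope S) x) = 0"
        if "Poly_Mapping.keys x \<subseteq> {1..n}" for x
        using a' assms(2)[OF that] that by (simp add: left_diff_distrib sum_subtractf)
      then have "a' S - a S = 0"
        using True by (rule schubert_indicators_independent)
      then show ?thesis
        by simp
    next
      case False
      then show ?thesis
        using a' assms(1) by simp
    qed
  qed
qed (use assms in auto)

lemma schubert_coeff_matroid:
  assumes "M \<in> matroids r n"
  shows "\<And>S. S \<notin> schubert_matroids r n \<Longrightarrow> schubert_coeff r n M S = 0"
    and "(\<Sum>S\<in>schubert_matroids r n. schubert_coeff r n M S) = 1"
proof -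
  obtain a :: "matroid \<Rightarrow> int" where a: "\<And>S. S \<notin> schubert_matroids r n \<Longrightarrow> a S = 0"
    "\<And>x. indicator (base_polytope M) x =
      (\<Sum>S\<in>schubert_matroids r n. a S * indicator (base_polytope S) x)"
    "(\<Sum>S\<in>schubert_matroids r n. a S) = 1"
    using schubert_expansion_exists[OF assms] by blast
  then have "schubert_coeff r n M = a"
    by (intro schubert_coeff_eqI) auto
  then show "\<And>S. S \<notin> schubert_matroids r n \<Longrightarrow> schubert_coeff r n M S = 0"
    "(\<Sum>S\<in>schubert_matroids r n. schubert_coeff r n M S) = 1"
    using a by auto
qed

lemma schubert_coeff_schubert:
  assumes "S \<in> schubert_matroids r n"
  shows "schubert_coeff r n S = (\<lambda>T. of_bool (T = S))"
proof (rule schubert_coeff_eqI)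
  fix x
  have "(\<Sum>T\<in>schubert_matroids r n. of_bool (T = S) * indicator (base_polytope T) x) =
      (\<Sum>T\<in>schubert_matroids r n. if T = S then indicator (base_polytope S) x else 0 :: int)"
    by (intro sum.cong) auto
  then show "indicator (base_polytope S) x =
      (\<Sum>T\<in>schubert_matroids r n. of_bool (T = S) * indicator (base_polytope T) x :: int)"
    using assms finite_schubert_matroids by simp
qed (use assms in auto)

section \<open>Isomorphism classes of matroids\<close>

lemma equiv_matroid_iso: "equiv (matroids r n) (matroid_iso r n)"
proof (rule equivI)
  show "matroid_iso r n \<subseteq> matroids r n \<times> matroids r n"
    unfolding matroid_iso_def by blast
  show "refl_on (matroids r n) (matroid_iso r n)"
  proof (rule refl_onI)
    fix M assume "M \<in> matroids r n"
    then show "(M, M) \<in> matroid_iso r n"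
      unfolding matroid_iso_def by (auto intro!: exI[of _ id])
  qed
  show "sym (matroid_iso r n)"
  proof (rule symI)
    fix M N assume "(M, N) \<in> matroid_iso r n"
    then obtain \<sigma> where \<sigma>: "bij_betw \<sigma> {1..n} {1..n}" "N = (\<lambda>B. \<sigma> ` B) ` M"
      and MN: "M \<in> matroids r n" "N \<in> matroids r n"
      unfolding matroid_iso_def by blast
    let ?\<tau> = "inv_into {1..n} \<sigma>"
    have "?\<tau> ` \<sigma> ` B = B" if "B \<in> M" for B
      using that matroidsD(2)[OF MN(1)] \<sigma>(1) by (intro inv_into_image_cancel bij_betw_imp_inj_on)
    then have "M = (\<lambda>B. ?\<tau> ` B) ` N"
      unfolding \<sigma>(2) by (simp add: image_image cong: image_cong)
    then show "(N, M) \<in> matroid_iso r n"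
      using MN bij_betw_inv_into[OF \<sigma>(1)] unfolding matroid_iso_def by blast
  qed
  show "trans (matroid_iso r n)"
  proof (rule transI)
    fix L M N assume "(L, M) \<in> matroid_iso r n" "(M, N) \<in> matroid_iso r n"
    then obtain \<sigma> \<tau> where \<sigma>\<tau>: "bij_betw \<sigma> {1..n} {1..n}" "M = (\<lambda>B. \<sigma> ` B) ` L"
      "bij_betw \<tau> {1..n} {1..n}" "N = (\<lambda>B. \<tau> ` B) ` M" and LN: "L \<in> matroids r n" "N \<in> matroids r n"
      unfolding matroid_iso_def by blast
    have "N = (\<lambda>B. (\<tau> \<circ> \<sigma>) ` B) ` L"
      unfolding \<sigma>\<tau>(2,4) by (simp add: image_image image_comp)
    then show "(L, N) \<in> matroid_iso r n"
      using LN bij_betw_trans[OF \<sigma>\<tau>(1,3)] unfolding matroid_iso_def by blast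
  qed
qed

lemma schubert_classes_subset: "schubert_classes r n \<subseteq> matroids r n // matroid_iso r n"
  unfolding schubert_classes_def quotient_def using schubert_subset_matroids by blast

lemma finite_schubert_classes: "finite (schubert_classes r n)"
  unfolding schubert_classes_def quotient_def using finite_schubert_matroids by blast

lemma schubert_classes_disjoint:
  "c \<in> schubert_classes r n \<Longrightarrow> d \<in> schubert_classes r n \<Longrightarrow> S \<in> c \<Longrightarrow> S \<in> d \<Longrightarrow> c = d"
  using quotient_disj[OF equiv_matroid_iso] schubert_classes_subset by blast

lemma finite_schubert_class: "c \<in> schubert_classes r n \<Longrightarrow> finite c"
  using in_quotient_imp_subset[OF equiv_matroid_iso] schubert_classes_subset finite_matroids
  by (metis finite_subset subsetD)

text \<open>The classes are disjoint and cover all Schubert matroids; at any other matroid in their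
  union \<open>a\<close> vanishes.\<close>

lemma sum_schubert_classes:
  assumes "\<And>S. S \<notin> schubert_matroids r n \<Longrightarrow> a S = 0"
  shows "(\<Sum>c\<in>schubert_classes r n. \<Sum>S\<in>c. a S) = (\<Sum>S\<in>schubert_matroids r n. a S)"
proof -
  have "S \<in> \<Union>(schubert_classes r n)" if S: "S \<in> schubert_matroids r n" for S
  proof
    show "matroid_iso r n `` {S} \<in> schubert_classes r n"
      unfolding schubert_classes_def using S by (rule quotientI)
    show "S \<in> matroid_iso r n `` {S}"
      using S schubert_subset_matroids by (intro equiv_class_self[OF equiv_matroid_iso]) blast
  qed
  then have "(\<Sum>S\<in>schubert_matroids r n. a S) = (\<Sum>S\<in>\<Union>(schubert_classes r n). a S)"
    using assms finite_schubert_classes finite_schubert_class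
    by (intro sum.mono_neutral_left) auto
  also have "\<dots> = (sum \<circ> sum) a (schubert_classes r n)"
    using finite_schubert_class schubert_classes_disjoint by (intro sum.Union_disjoint) blast+
  finally show ?thesis
    by simp
qed

lemma matroids_nonempty:
  assumes "r \<le> n"
  shows "matroids r n \<noteq> {}"
proof -
  \<comment> \<open>A single cap \<open>r\<close> on the ground set cuts out the uniform
    matroid.\<close>
  have "{1..r} \<in> capped_sets r n {{1..n}} (\<lambda>_. r)"
    using assms unfolding capped_sets_def by (auto simp: Int_absorb2)
  then have "capped_sets r n {{1..n}} (\<lambda>_. r) \<in> matroids r n"
    by (intro capped_sets_matroid) (auto simp: chain_subset_def)
  then show ?thesis
    by blast
qed

theorem theorem3p6:
  fixes r n :: nat
  assumes "r \<le> n"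
  shows "affine_dim (Omega r n) = int (card (schubert_classes r n)) - 1
       \<and> affine_dim (Omega_bar r n) = int (card (schubert_matroids r n)) - 1"
proof
  show "affine_dim (Omega r n) = int (card (schubert_classes r n)) - 1"
    unfolding Omega_def
  proof (rule affine_dim_convex_hull[OF finite_schubert_classes])
    fix x assume "x \<in> class_vec r n ` matroids r n"
    then obtain M where M: "M \<in> matroids r n" "x = class_vec r n M"
      by blast
    show "Poly_Mapping.keys x \<subseteq> schubert_classes r n"
      unfolding M(2) class_vec_def by (rule keys_sum_single)
    have "coord_sum x (schubert_classes r n) =
        of_int (\<Sum>c\<in>schubert_classes r n. \<Sum>S\<in>c. schubert_coeff r n M S)"
      unfolding M(2) class_vec_def by (simp add: coord_sum_sum_single finite_schubert_classes)
    then show "coord_sum x (schubert_classes r n) = 1"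
      using schubert_coeff_matroid[OF M(1)] by (simp add: sum_schubert_classes)
  next
    fix c assume c: "c \<in> schubert_classes r n"
    then obtain S where S: "S \<in> schubert_matroids r n" "c = matroid_iso r n `` {S}"
      unfolding schubert_classes_def by (auto elim: quotientE)
    then have Sc: "S \<in> c"
      using schubert_subset_matroids equiv_class_self[OF equiv_matroid_iso] by blast
    have "class_vec r n S = Poly_Mapping.single c 1"
      unfolding class_vec_def
    proof (rule sum_single_delta[OF finite_schubert_classes c])
      fix d assume d: "d \<in> schubert_classes r n"
      \<comment> \<open>Only one class contains \<open>S\<close>, so the unit vector at
        \<open>S\<close> becomes the unit vector at its class.\<close>
      then have "S \<in> d \<longleftrightarrow> d = c"
        using schubert_classes_disjoint[OF d c] Sc by blast
      moreover have "(\<Sum>T\<in>d. of_bool (T = S)) = (of_bool (S \<in> d) :: int)"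
        using finite_schubert_class[OF d] by (simp add: of_bool_def)
      ultimately show "of_int (\<Sum>T\<in>d. schubert_coeff r n S T) = (of_bool (d = c) :: real)"
        by (simp add: schubert_coeff_schubert[OF S(1)])
    qed
    then show "Poly_Mapping.single c 1 \<in> class_vec r n ` matroids r n"
      using S(1) schubert_subset_matroids by (metis image_eqI subsetD)
  qed (use matroids_nonempty[OF assms] in simp)
  show "affine_dim (Omega_bar r n) = int (card (schubert_matroids r n)) - 1"
    unfolding Omega_bar_def
  proof (rule affine_dim_convex_hull[OF finite_schubert_matroids])
    fix x assume "x \<in> matroid_vec r n ` matroids r n"
    then obtain M where M: "M \<in> matroids r n" "x = matroid_vec r n M"
      by blast
    show "Poly_Mapping.keys x \<subseteq> schubert_matroids r n"
      unfolding M(2) matroid_vec_def by (rule keys_sum_single)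
    have "coord_sum x (schubert_matroids r n) = of_int (\<Sum>S\<in>schubert_matroids r n. schubert_coeff r n M S)"
      unfolding M(2) matroid_vec_def by (simp add: coord_sum_sum_single finite_schubert_matroids)
    then show "coord_sum x (schubert_matroids r n) = 1"
      using schubert_coeff_matroid(2)[OF M(1)] by simp
  next
    fix S assume S: "S \<in> schubert_matroids r n"
    have "matroid_vec r n S = Poly_Mapping.single S 1"
      unfolding matroid_vec_def schubert_coeff_schubert[OF S]
      by (rule sum_single_delta[OF finite_schubert_matroids S]) simp
    then show "Poly_Mapping.single S 1 \<in> matroid_vec r n ` matroids r n"
      using S schubert_subset_matroids by (metis image_eqI subsetD)
  qed (use matroids_nonempty[OF assms] in simp)
qed

end
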